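(* Let $\mathcal G$ be an infinite connected subgraph of $\mathbb B$ with natural weights. There exist constants $c_1,c_2>0$ such that the following holds. Let $x,y\in\mathcal G$ and $t>0$ be such that $N:=\lfloor\sqrt{d(x,y)^3/t}\rfloor\ge8$, and suppose the event $F_*\big(x,y,d(x,y)N^{-1},\frac18N;\,d(x,y)^3t^{-2/3},N\big)$ holds. Then $$q_t(x,y)\le c_1t^{-2/3}\exp(-c_2N).$$
   Context: $\mathbb B$ is the rooted tree in which every vertex has $n_0\ge2$ children; $\gamma(x,y)$ is the unique geodesic path from $x$ to $y$, and $z$ is a middle point of $\gamma(x,y)$ if $z\in\gamma(x,y)$ and $|d(x,z)-\frac12d(x,y)|\le\frac12$. On $\mathcal G$ (a fixed, deterministic subtree): $\mu_{xy}=1$ for adjacent $x,y$, $0$ otherwise; $\mu_x$ is the degree in $\mathcal G$, $\mu(A)=\sum_{x\in A}\mu_x$, $d$ the graph distance, $B(x,r)=\{y\in\mathcal G:d(x,y)\le r\}$, $V(x,r)=\mu(B(x,r))$. $Y$ is the continuous-time simple random walk on $\mathcal G$ (exponential mean-1 holding times, jumps to a uniform neighbour) with law $P^x$, and $q_t(x,y)=P^x(Y_t=y)/\mu_y$. $M(x,r)$ is the smallest $m$ such that there is $A=\{z_1,\dots,z_m\}\subset\mathcal G$ with $d(x,z_i)\in[r/4,3r/4]$ for all $i$ such that every path in $\mathcal G$ from $x$ to $\mathcal G\setminus B(x,r)$ passes through $A$. For $\lambda\ge64$, $B(x,r)$ is $\lambda$-good if: $x\in\mathcal G$; $r^2\lambda^{-2}\le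 V(x,r)\le r^2\lambda$; $M(x,r)\le\lambda/64$; $V(x,r/\lambda)\ge r^2\lambda^{-4}$; $V(x,r/\lambda^2)\ge r^2\lambda^{-6}$. $\lambda_1\ge64$ is a fixed absolute constant (chosen in the paper so that, for the incipient infinite cluster, balls fail to be $\lambda_1$-good with probability at most $1/4$). Conditions: $F_1(x,y,r,k)$ holds if $x,y\in\mathcal G$ and there exist at least $k$ disjoint balls $B(z,r/2)$ with $z\in\gamma(x,y)$ which are $\lambda_1$-good. $A_*(z,r,N)$ holds if $z\in\mathcal G$ and $B(z,r)$ is $N$-good. With $z_0$ a middle point of $\gamma(x,y)$, $F_*(x,y,R,k;r,N)$ holds if $F_1(x,z_0,R,k/2)$, $F_1(z_0,y,R,k/2)$, $A_*(x,r,N)$, $A_*(z_0,r,N)$ and $A_*(y,r,N)$ all hold. *)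

theory Defs
  imports "HOL-Analysis.Analysis"
begin

text \<open>Vertices of B are finite words over {0..<n0}; the root is the empty word and
  the children of w are the words i # w with i < n0.\<close>

definition Bverts :: "nat \<Rightarrow> nat list set" where
  "Bverts n0 = {w. \<forall>i\<in>set w. i < n0}"

definition adjB :: "nat \<Rightarrow> nat list \<Rightarrow> nat list \<Rightarrow> bool" where
  "adjB n0 x y \<longleftrightarrow> x \<in> Bverts n0 \<and> y \<in> Bverts n0 \<and>
     ((\<exists>i<n0. x = i # y) \<or> (\<exists>i<n0. y = i # x))"

definition adjG :: "nat \<Rightarrow> nat list set \<Rightarrow> nat list \<Rightarrow> nat list \<Rightarrow> bool" where
  "adjG n0 G x y \<longleftrightarrow> x \<in> G \<and> y \<in> G \<and> adjB n0 x y"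

definition gpath :: "nat \<Rightarrow> nat list set \<Rightarrow> nat list list \<Rightarrow> nat list \<Rightarrow> nat list \<Rightarrow> bool" where
  "gpath n0 G p x y \<longleftrightarrow> p \<noteq> [] \<and> hd p = x \<and> last p = y \<and> set p \<subseteq> G \<and>
     (\<forall>i. Suc i < length p \<longrightarrow> adjG n0 G (p ! i) (p ! Suc i))"

definition connectedG :: "nat \<Rightarrow> nat list set \<Rightarrow> bool" where
  "connectedG n0 G \<longleftrightarrow> (\<forall>x\<in>G. \<forall>y\<in>G. \<exists>p. gpath n0 G p x y)"

definition gdist :: "nat \<Rightarrow> nat list set \<Rightarrow> nat list \<Rightarrow> nat list \<Rightarrow> nat" where
  "gdist n0 G x y = (LEAST n. \<exists>p. gpath n0 G p x y \<and> length p = Suc n)"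

definition geod :: "nat \<Rightarrow> nat list set \<Rightarrow> nat list \<Rightarrow> nat list \<Rightarrow> nat list set" where
  "geod n0 G x y = {z. \<exists>p. gpath n0 G p x y \<and> length p = Suc (gdist n0 G x y) \<and> z \<in> set p}"

definition middle_point :: "nat \<Rightarrow> nat list set \<Rightarrow> nat list \<Rightarrow> nat list \<Rightarrow> nat list \<Rightarrow> bool" where
  "middle_point n0 G x y z \<longleftrightarrow> z \<in> geod n0 G x y \<and>
     \<bar>real (gdist n0 G x z) - real (gdist n0 G x y) / 2\<bar> \<le> 1/2"

definition mu :: "nat \<Rightarrow> nat list set \<Rightarrow> nat list \<Rightarrow> real" where
  "mu n0 G x = real (card {y. adjG n0 G x y})"

definition muset :: "nat \<Rightarrow> nat list set \<Rightarrow> nat list set \<Rightarrow> real" where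
  "muset n0 G A = (\<Sum>x\<in>A. mu n0 G x)"

definition gball :: "nat \<Rightarrow> nat list set \<Rightarrow> nat list \<Rightarrow> real \<Rightarrow> nat list set" where
  "gball n0 G x r = {y \<in> G. real (gdist n0 G x y) \<le> r}"

definition Vol :: "nat \<Rightarrow> nat list set \<Rightarrow> nat list \<Rightarrow> real \<Rightarrow> real" where
  "Vol n0 G x r = muset n0 G (gball n0 G x r)"

text \<open>M(x,r), with value infinity if no cut set exists.\<close>
definition cutset :: "nat \<Rightarrow> nat list set \<Rightarrow> nat list \<Rightarrow> real \<Rightarrow> nat list set \<Rightarrow> bool" where
  "cutset n0 G x r A \<longleftrightarrow> finite A \<and>
     (\<forall>z\<in>A. z \<in> G \<and> r/4 \<le> real (gdist n0 G x z) \<and> real (gdist n0 G x z) \<le> 3*r/4) \<and>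
     (\<forall>p w. gpath n0 G p x w \<and> w \<in> G - gball n0 G x r \<longrightarrow> set p \<inter> A \<noteq> {})"

definition Mcut :: "nat \<Rightarrow> nat list set \<Rightarrow> nat list \<Rightarrow> real \<Rightarrow> ereal" where
  "Mcut n0 G x r = Inf {ereal (real (card A)) | A. cutset n0 G x r A}"

text \<open>lambda-good balls (the notion is defined for lambda \<ge> 64).\<close>
definition good :: "nat \<Rightarrow> nat list set \<Rightarrow> real \<Rightarrow> nat list \<Rightarrow> real \<Rightarrow> bool" where
  "good n0 G lam x r \<longleftrightarrow> lam \<ge> 64 \<and> x \<in> G \<and>
     r^2 / lam^2 \<le> Vol n0 G x r \<and> Vol n0 G x r \<le> r^2 * lam \<and>
     Mcut n0 G x r \<le> ereal (lam / 64) \<and>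
     Vol n0 G x (r / lam) \<ge> r^2 / lam^4 \<and>
     Vol n0 G x (r / lam^2) \<ge> r^2 / lam^6"

text \<open>The conditions F_1, A_*, F_* (lam1 is the fixed constant lambda_1;
  z0 is the chosen middle point).\<close>
definition F1 :: "nat \<Rightarrow> nat list set \<Rightarrow> real \<Rightarrow> nat list \<Rightarrow> nat list \<Rightarrow> real \<Rightarrow> real \<Rightarrow> bool" where
  "F1 n0 G lam1 x y r k \<longleftrightarrow> x \<in> G \<and> y \<in> G \<and>
     (\<exists>Z. finite Z \<and> Z \<subseteq> geod n0 G x y \<and> real (card Z) \<ge> k \<and>
        (\<forall>z\<in>Z. \<forall>z'\<in>Z. z \<noteq> z' \<longrightarrow> gball n0 G z (r/2) \<inter> gball n0 G z' (r/2) = {}) \<and>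
        (\<forall>z\<in>Z. good n0 G lam1 z (r/2)))"

definition Astar :: "nat \<Rightarrow> nat list set \<Rightarrow> nat list \<Rightarrow> real \<Rightarrow> real \<Rightarrow> bool" where
  "Astar n0 G z r N \<longleftrightarrow> z \<in> G \<and> good n0 G N z r"

definition Fstar :: "nat \<Rightarrow> nat list set \<Rightarrow> real \<Rightarrow> nat list \<Rightarrow> nat list \<Rightarrow> nat list
     \<Rightarrow> real \<Rightarrow> real \<Rightarrow> real \<Rightarrow> real \<Rightarrow> bool" where
  "Fstar n0 G lam1 z0 x y R k r N \<longleftrightarrow>
     F1 n0 G lam1 x z0 R (k/2) \<and> F1 n0 G lam1 z0 y R (k/2) \<and>
     Astar n0 G x r N \<and> Astar n0 G z0 r N \<and> Astar n0 G y r N"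

fun pstep :: "nat \<Rightarrow> nat list set \<Rightarrow> nat \<Rightarrow> nat list \<Rightarrow> nat list \<Rightarrow> real" where
  "pstep n0 G 0 x y = (if x = y then 1 else 0)"
| "pstep n0 G (Suc k) x y =
     (\<Sum>z\<in>{z. adjG n0 G x z}. pstep n0 G k z y / mu n0 G x)"

text \<open>With exponential mean-one holding times, the number of jumps up to time t is
  Poisson(t) and independent of the jump chain, so
  P^x(Y_t = y) = sum_k e^{-t} t^k / k! * p_k(x,y).\<close>
definition PY :: "nat \<Rightarrow> nat list set \<Rightarrow> real \<Rightarrow> nat list \<Rightarrow> nat list \<Rightarrow> real" where
  "PY n0 G t x y = (\<Sum>k. exp (-t) * t^k / fact k * pstep n0 G k x y)"

definition qt :: "nat \<Rightarrow> nat list set \<Rightarrow> real \<Rightarrow> nat list \<Rightarrow> nat list \<Rightarrow> real" where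
  "qt n0 G t x y = PY n0 G t x y / mu n0 G y"

end

theory Submission
  imports Defs "HOL-Library.Sublist"
begin

text \<open>
  Let \<open>z\<close> be the middle point and let \<open>u(x)\<close> be the Laplace transform at \<open>\<theta>\<close> of the hitting time of
  \<open>z\<close> by the walk from \<open>x\<close>. Splitting at time \<open>t/2\<close> and using reversibility together with the
  parabolic maximum principle, \<open>q\<^sub>t(x,y)\<close> is at most \<open>exp(\<theta> t) (u(x) + u(y))\<close> times the supremum of
  \<open>q\<^sub>s(z,x)\<close> and \<open>q\<^sub>s(z,y)\<close> over \<open>s\<close> in \<open>[t/2, t]\<close>. By reversibility \<open>q\<^sub>s(z,x)\<close> is at most the mean
  of \<open>q\<^sub>s(z,z)\<close> and \<open>q\<^sub>s(x,x)\<close>, and the on-diagonal bound \<open>q\<^sub>s(w,w) \<le> max (2 / V(w,\<rho>)) (4 \<rho> / s)\<close>, a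
  consequence of \<open>(f(w) - f(v))\<^sup>2 \<le> d(w,v) \<E>(f,f)\<close>, makes the supremum \<open>O(N\<^sup>2 t powr (-2/3))\<close>.

  The decay of \<open>u\<close> is diffusive: along the geodesic towards \<open>z\<close> the increment of \<open>u\<close> over an edge is
  \<open>\<theta>\<close> times the \<open>u\<close>-weighted volume behind that edge. A good ball contributes volume of order \<open>r\<^sup>2\<close>
  on which \<open>u\<close> is comparable to its value at the centre (here the small cut set enters), so the
  values \<open>U\<^sub>i\<close> of \<open>u\<close> at consecutive good balls satisfy \<open>U\<^sub>i\<^sub>+\<^sub>1 \<ge> U\<^sub>i + \<sigma>\<^sup>2 (U\<^sub>0 + ... + U\<^sub>i)\<close> with \<open>\<sigma>\<^sup>2\<close>
  of order \<open>\<theta> r\<^sup>3\<close>, whence \<open>U\<^sub>i\<close> grows like \<open>(1 + \<sigma>)\<^sup>i\<close>. Since \<open>\<theta> t\<close> is of order \<open>\<sigma>\<^sup>2 N\<close> only, a small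
  constant \<open>\<sigma>\<close> makes the gain \<open>exp(- c \<sigma> N)\<close> beat the loss \<open>exp(C \<sigma>\<^sup>2 N)\<close>.
\<close>

section \<open>Preliminaries\<close>

lemma bounded_range_absE:
  assumes "bounded (range (f :: 'a \<Rightarrow> real))"
  obtains C where "C \<ge> 0" "\<And>x. \<bar>f x\<bar> \<le> C"
  using assms by (auto simp: bounded_pos intro: less_imp_le)

lemma bounded_range_absI: "(\<And>x. \<bar>f x :: real\<bar> \<le> C) \<Longrightarrow> bounded (range f)"
  by (auto simp: bounded_iff)

lemma has_sum_sum:
  fixes f :: "'i \<Rightarrow> 'b \<Rightarrow> 'c :: {comm_monoid_add, topological_comm_monoid_add}"
  assumes "\<And>i. i \<in> I \<Longrightarrow> (f i has_sum s i) A"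
  shows "((\<lambda>w. \<Sum>i\<in>I. f i w) has_sum (\<Sum>i\<in>I. s i)) A"
  using assms by (induction I rule: infinite_finite_induct) (auto intro: has_sum_add)

lemma has_sum_diff:
  fixes f g :: "'b \<Rightarrow> 'c :: topological_ab_group_add"
  assumes "(f has_sum a) A" "(g has_sum b) A"
  shows "((\<lambda>w. f w - g w) has_sum a - b) A"
  using has_sum_add[OF assms(1), of "\<lambda>w. - g w" "- b"] assms(2) by (simp add: has_sum_uminus)

lemma relpowp_funI:
  assumes "\<And>l. l < n \<Longrightarrow> R (f (i + l)) (f (Suc (i + l)))"
  shows "(R ^^ n) (f i) (f (i + n))"
  unfolding relpowp_fun_conv using assms by (intro exI[of _ "\<lambda>l. f (i + l)"]) simp

lemma relpowp_imp_simple_path: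
  assumes "(R ^^ n) x y"
  obtains p m where "m \<le> n" "p 0 = x" "p m = y" "inj_on p {..m}"
    "\<And>i. i < m \<Longrightarrow> R (p i) (p (Suc i))"
proof -
  define m where "m = (LEAST m. (R ^^ m) x y)"
  have "(R ^^ m) x y" unfolding m_def using assms by (rule LeastI)
  then obtain p where p: "p 0 = x" "p m = y" "\<And>i. i < m \<Longrightarrow> R (p i) (p (Suc i))"
    unfolding relpowp_fun_conv by blast
  have segment: "(R ^^ (j - i)) (p i) (p j)" if "i \<le> j" "j \<le> m" for i j
    using relpowp_funI[of "j - i" R p i] p(3) that by simp
  have "p i \<noteq> p j" if "i < j" "j \<le> m" for i j
  proof
    assume "p i = p j"
    then have "(R ^^ (i + (m - j))) x y"
      using segment[of 0 i] segment[of j m] p(1,2) that unfolding relpowp_add by auto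
    then have "m \<le> i + (m - j)" unfolding m_def by (rule Least_le)
    then show False using that by simp
  qed
  then have "inj_on p {..m}" by (intro linorder_inj_onI) auto
  moreover have "m \<le> n" unfolding m_def using assms by (rule Least_le)
  ultimately show ?thesis using p that by blast
qed

lemma le_divide_of_square_le_deriv:
  fixes \<phi> e :: "real \<Rightarrow> real"
  assumes deriv: "\<And>r. 0 \<le> r \<Longrightarrow> r \<le> s \<Longrightarrow> (\<phi> has_real_derivative - e r) (at r)"
    and pos: "\<And>r. 0 \<le> r \<Longrightarrow> r \<le> s \<Longrightarrow> \<phi> r > 0"
    and square: "\<And>r. 0 \<le> r \<Longrightarrow> r \<le> s \<Longrightarrow> (\<phi> r)\<^sup>2 \<le> C * e r"
    and C: "C > 0" and s: "s > 0"
  shows "\<phi> s \<le> C / s"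
proof -
  define h where "h r = r / C - 1 / \<phi> r" for r
  have "h s \<le> h 0"
  proof (rule DERIV_nonpos_imp_nonincreasing[of 0 s h])
    fix r assume r: "0 \<le> r" "r \<le> s"
    have "(h has_real_derivative 1 / C - e r / (\<phi> r)\<^sup>2) (at r)"
      unfolding h_def
      by (rule derivative_eq_intros deriv[OF r] refl
          | use pos[OF r] C in \<open>simp add: power2_eq_square\<close>)+
    moreover have "1 / C - e r / (\<phi> r)\<^sup>2 \<le> 0"
      using square[OF r] pos[OF r] C by (simp add: field_simps)
    ultimately show "\<exists>d. (h has_real_derivative d) (at r) \<and> d \<le> 0" by blast
  qed (use s in simp)
  also have "h 0 \<le> 0" using pos[of 0] s by (simp add: h_def)
  finally have "s / C \<le> 1 / \<phi> s" by (simp add: h_def)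
  then show ?thesis using pos[of s] s C by (simp add: field_simps)
qed

section \<open>Poisson means of bounded sequences\<close>

definition poisson_mean :: "real \<Rightarrow> (nat \<Rightarrow> real) \<Rightarrow> real" where
  "poisson_mean t c = (\<Sum>k. exp (- t) * t ^ k / fact k * c k)"

lemma poisson_weights_sums_1: "(\<lambda>k. exp (- t) * t ^ k / fact k) sums (1 :: real)"
proof -
  have "(\<lambda>k. exp (- t) * (t ^ k /\<^sub>R fact k)) sums (exp (- t) * exp t)"
    by (intro sums_mult exp_converges)
  then show ?thesis by (simp add: exp_minus field_simps)
qed

lemma summable_norm_poisson_mean:
  fixes c :: "nat \<Rightarrow> real"
  assumes "bounded (range c)"
  shows "summable (\<lambda>k. norm (exp (- t) * t ^ k / fact k * c k))"
proof -
  obtain C where C: "\<And>k. \<bar>c k\<bar> \<le> C" using assms by (rule bounded_range_absE) blast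
  have "summable (\<lambda>k. exp (- t) * C * (\<bar>t\<bar> ^ k / fact k))"
    using summable_exp[of "\<bar>t\<bar>"] by (intro summable_mult) (simp add: divide_inverse mult.commute)
  moreover have "norm (norm (exp (- t) * t ^ k / fact k * c k))
      \<le> exp (- t) * C * (\<bar>t\<bar> ^ k / fact k)" for k
    using mult_left_mono[OF C, of "exp (- t) * \<bar>t\<bar> ^ k / fact k" k]
    by (simp add: abs_mult power_abs mult_ac)
  ultimately show ?thesis by (rule summable_comparison_test')
qed

lemma poisson_mean_sums:
  "bounded (range c) \<Longrightarrow> (\<lambda>k. exp (- t) * t ^ k / fact k * c k) sums poisson_mean t c"
  unfolding poisson_mean_def
  by (rule summable_sums[OF summable_norm_cancel[OF summable_norm_poisson_mean]])

lemma poisson_mean_const [simp]: "poisson_mean t (\<lambda>k. C) = C"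
  unfolding poisson_mean_def
  using sums_mult2[OF poisson_weights_sums_1, of t C] by (simp add: sums_iff)

lemma poisson_mean_0 [simp]: "poisson_mean 0 c = c 0"
proof -
  have "(\<lambda>k. exp (- 0) * 0 ^ k / fact k * c k) = (\<lambda>k. (c k / fact k) * 0 ^ k)" by auto
  then show ?thesis unfolding poisson_mean_def by (simp only: powser_zero) simp
qed

lemma poisson_mean_mono:
  assumes "bounded (range c)" "bounded (range d)" "\<And>k. c k \<le> d k" "t \<ge> 0"
  shows "poisson_mean t c \<le> poisson_mean t d"
proof (rule sums_le[OF _ assms(1,2)[THEN poisson_mean_sums]])
  show "exp (- t) * t ^ k / fact k * c k \<le> exp (- t) * t ^ k / fact k * d k" for k
    using assms(3,4) by (intro mult_left_mono) auto
qed

lemma poisson_mean_add: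
  assumes "bounded (range c)" "bounded (range d)"
  shows "poisson_mean t (\<lambda>k. c k + d k) = poisson_mean t c + poisson_mean t d"
  using sums_add[OF assms[THEN poisson_mean_sums], of t]
  by (simp add: poisson_mean_def sums_iff distrib_left)

lemma poisson_mean_cmult:
  assumes "bounded (range c)"
  shows "poisson_mean t (\<lambda>k. a * c k) = a * poisson_mean t c"
  using sums_mult[OF poisson_mean_sums[OF assms], of a t]
  by (simp add: poisson_mean_def sums_iff mult_ac)

lemma poisson_mean_sum:
  assumes "\<And>i. i \<in> I \<Longrightarrow> bounded (range (c i))"
  shows "poisson_mean t (\<lambda>k. \<Sum>i\<in>I. c i k) = (\<Sum>i\<in>I. poisson_mean t (c i))"
  using sums_sum[of I _ "\<lambda>i. poisson_mean t (c i)", OF poisson_mean_sums[OF assms]]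
  by (simp add: poisson_mean_def sums_iff sum_distrib_left)

lemma DERIV_poisson_mean:
  assumes "bounded (range c)"
  shows "((\<lambda>t. poisson_mean t c) has_real_derivative
    poisson_mean t (\<lambda>k. c (Suc k)) - poisson_mean t c) (at t)"
proof -
  define F where "F c t = (\<Sum>k. c k / fact k * t ^ k)" for c :: "nat \<Rightarrow> real" and t
  have F: "summable (\<lambda>k. c k / fact k * t ^ k)" "poisson_mean t c = exp (- t) * F c t"
    if "bounded (range c)" for c :: "nat \<Rightarrow> real" and t
  proof -
    have unweighted: "exp t * (exp (- t) * t ^ k / fact k * c k) = c k / fact k * t ^ k" for k
      by (simp add: exp_minus)
    have "(\<lambda>k. c k / fact k * t ^ k) sums (exp t * poisson_mean t c)"
      using sums_mult[OF poisson_mean_sums[OF that], of "exp t" t] by (simp only: unweighted)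
    then show "summable (\<lambda>k. c k / fact k * t ^ k)" "poisson_mean t c = exp (- t) * F c t"
      by (auto simp: F_def sums_iff exp_minus)
  qed
  have bounded_Suc: "bounded (range (\<lambda>k. c (Suc k)))"
    by (rule bounded_subset[OF assms]) auto
  have diffs: "diffs (\<lambda>k. c k / fact k) = (\<lambda>k. c (Suc k) / fact k)"
    by (auto simp: diffs_def fun_eq_iff divide_simps)
  have "(F c has_real_derivative F (\<lambda>k. c (Suc k)) t) (at t)"
    using termdiffs_strong_converges_everywhere[OF F(1)[OF assms], of t]
    by (simp add: F_def[abs_def] diffs)
  then have "((\<lambda>t. exp (- t) * F c t) has_real_derivative
      exp (- t) * F (\<lambda>k. c (Suc k)) t - exp (- t) * F c t) (at t)"
    by (auto intro!: derivative_eq_intros simp: algebra_simps)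
  then show ?thesis by (simp only: F(2)[OF assms] F(2)[OF bounded_Suc])
qed

lemma has_sum_poisson_mean:
  assumes sum: "\<And>k. (a k has_sum c k) A" and nonneg: "\<And>k w. w \<in> A \<Longrightarrow> a k w \<ge> 0"
    and c: "bounded (range c)" and t: "t \<ge> 0"
  shows "((\<lambda>w. poisson_mean t (\<lambda>k. a k w)) has_sum poisson_mean t c) A"
proof -
  define f where "f = (\<lambda>(k, w). exp (- t) * t ^ k / fact k * a k w)"
  have over_k: "((\<lambda>k. exp (- t) * t ^ k / fact k * d k) has_sum poisson_mean t d) UNIV"
    if "bounded (range d)" for d
    by (intro norm_summable_imp_has_sum summable_norm_poisson_mean poisson_mean_sums that)
  have over_A: "((\<lambda>w. f (k, w)) has_sum exp (- t) * t ^ k / fact k * c k) A" for k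
    unfolding f_def using has_sum_cmult_right[OF sum, of "exp (- t) * t ^ k / fact k" k] by simp
  have "f summable_on UNIV \<times> A"
    by (rule summable_on_SigmaI[OF over_A has_sum_imp_summable[OF over_k[OF c]]])
      (use t nonneg in \<open>auto simp: f_def\<close>)
  then have "(f has_sum poisson_mean t c) (UNIV \<times> A)"
    by (rule has_sum_SigmaI[OF over_A over_k[OF c]])
  then have swapped: "((\<lambda>(w, k). f (k, w)) has_sum poisson_mean t c) (A \<times> UNIV)"
    by (subst (asm) has_sum_swap)
  have bounded_a: "bounded (range (\<lambda>k. a k w))" if w: "w \<in> A" for w
  proof -
    obtain C where C: "\<And>k. \<bar>c k\<bar> \<le> C" using c by (rule bounded_range_absE) blast
    have "\<bar>a k w\<bar> \<le> C" for k
      using finite_sum_le_has_sum[OF sum[of k], of "{w}"] nonneg w C[of k] by fastforce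
    then show ?thesis by (rule bounded_range_absI)
  qed
  show ?thesis
    by (rule has_sum_SigmaD[OF swapped]) (use over_k[OF bounded_a] in \<open>simp add: f_def\<close>)
qed

section \<open>The heat semigroup of a locally finite graph\<close>

locale locally_finite_graph =
  fixes E :: "'a \<Rightarrow> 'a \<Rightarrow> bool"
  assumes E_sym: "E x y \<Longrightarrow> E y x"
    and finite_nbrs: "finite {y. E x y}"
begin

definition deg :: "'a \<Rightarrow> real" where
  "deg x = real (card {y. E x y})"

definition avg :: "('a \<Rightarrow> real) \<Rightarrow> 'a \<Rightarrow> real" where
  "avg f x = (\<Sum>y | E x y. f y) / deg x" \<comment> \<open>0 at an isolated vertex\<close>

definition heat :: "real \<Rightarrow> ('a \<Rightarrow> real) \<Rightarrow> 'a \<Rightarrow> real" where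
  "heat t f x = poisson_mean t (\<lambda>k. (avg ^^ k) f x)"

abbreviation point_mass :: "'a \<Rightarrow> 'a \<Rightarrow> real" where
  "point_mass x \<equiv> indicator {x}"

lemma deg_nonneg [simp]: "deg x \<ge> 0"
  by (simp add: deg_def)

lemma deg_pos_iff: "deg x > 0 \<longleftrightarrow> (\<exists>y. E x y)"
  using finite_nbrs[of x] by (auto simp: deg_def card_gt_0_iff)

lemma deg_mult_avg: "deg x * avg f x = (\<Sum>y | E x y. f y)"
proof (cases "deg x = 0")
  case True
  then have "{y. E x y} = {}" using finite_nbrs[of x] by (simp add: deg_def)
  with True show ?thesis by simp
qed (simp add: avg_def)

lemma avg_le:
  assumes "\<And>y. E x y \<Longrightarrow> f y \<le> C" "C \<ge> 0"
  shows "avg f x \<le> C"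
proof (cases "deg x = 0")
  case True
  then show ?thesis using assms by (simp add: avg_def)
next
  case False
  have "(\<Sum>y | E x y. f y) \<le> deg x * C"
    using sum_bounded_above[of "{y. E x y}" f C] assms by (simp add: deg_def)
  then have "deg x * avg f x \<le> deg x * C" by (simp only: deg_mult_avg)
  then show ?thesis using False deg_nonneg[of x] by simp
qed

lemma avg_mono: "(\<And>y. E x y \<Longrightarrow> f y \<le> g y) \<Longrightarrow> avg f x \<le> avg g x"
  unfolding avg_def by (intro divide_right_mono sum_mono) auto

lemma avg_nonneg: "(\<And>y. E x y \<Longrightarrow> f y \<ge> 0) \<Longrightarrow> avg f x \<ge> 0"
  unfolding avg_def by (intro divide_nonneg_nonneg sum_nonneg) auto

lemma avg_add: "avg (\<lambda>w. f w + g w) x = avg f x + avg g x"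
  by (simp add: avg_def sum.distrib add_divide_distrib)

lemma avg_cmult: "avg (\<lambda>w. a * f w) x = a * avg f x"
  by (simp add: avg_def sum_distrib_left)

lemma avg_diff: "avg (\<lambda>w. f w - g w) x = avg f x - avg g x"
  by (simp add: avg_def sum_subtractf diff_divide_distrib)

lemma funpow_avg_add: "(avg ^^ k) (\<lambda>w. f w + g w) = (\<lambda>w. (avg ^^ k) f w + (avg ^^ k) g w)"
  by (induction k) (simp_all add: avg_add)

lemma funpow_avg_mono: "(\<And>y. f y \<le> g y) \<Longrightarrow> (avg ^^ k) f x \<le> (avg ^^ k) g x"
  by (induction k arbitrary: x) (auto intro: avg_mono)

lemma funpow_avg_nonneg: "(\<And>y. f y \<ge> 0) \<Longrightarrow> (avg ^^ k) f x \<ge> 0"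
  by (induction k arbitrary: x) (auto intro: avg_nonneg)

lemma abs_funpow_avg_le:
  assumes "\<And>y. \<bar>f y\<bar> \<le> C"
  shows "\<bar>(avg ^^ k) f x\<bar> \<le> C"
proof (induction k arbitrary: x)
  case (Suc k)
  have "C \<ge> 0" using assms[of x] by linarith
  moreover have "avg (\<lambda>w. a * (avg ^^ k) f w) x \<le> C" if "a = 1 \<or> a = -1" for a
    using Suc \<open>C \<ge> 0\<close> that by (intro avg_le) (auto simp: abs_le_iff)
  from this[of 1] this[of "-1"] show ?case unfolding avg_cmult by (simp add: abs_le_iff)
qed (use assms in simp)

lemma avg_funpow_avg: "(avg ^^ k) (avg f) = avg ((avg ^^ k) f)"
  by (simp add: funpow_swap1)

lemma bounded_funpow_avg:
  assumes "bounded (range f)"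
  shows "bounded (range ((avg ^^ k) f))" "bounded (range (\<lambda>k. (avg ^^ k) f x))"
proof -
  obtain C where "\<And>y. \<bar>f y\<bar> \<le> C" using assms by (rule bounded_range_absE) blast
  then have "\<bar>(avg ^^ k) f x\<bar> \<le> C" for k x by (rule abs_funpow_avg_le)
  then show "bounded (range ((avg ^^ k) f))" "bounded (range (\<lambda>k. (avg ^^ k) f x))"
    by (auto intro: bounded_range_absI)
qed

lemma bounded_avg: "bounded (range f) \<Longrightarrow> bounded (range (avg f))"
  using bounded_funpow_avg(1)[of f 1] by simp

lemma heat_0 [simp]: "heat 0 f x = f x"
  by (simp add: heat_def)

lemma heat_add:
  assumes "bounded (range f)" "bounded (range g)"
  shows "heat t (\<lambda>w. f w + g w) x = heat t f x + heat t g x"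
  unfolding heat_def funpow_avg_add by (intro poisson_mean_add bounded_funpow_avg assms)

lemma heat_mono:
  assumes "bounded (range f)" "bounded (range g)" "\<And>y. f y \<le> g y" "t \<ge> 0"
  shows "heat t f x \<le> heat t g x"
  unfolding heat_def by (intro poisson_mean_mono bounded_funpow_avg funpow_avg_mono assms)

lemma heat_nonneg:
  assumes "bounded (range f)" "\<And>y. f y \<ge> 0" "t \<ge> 0"
  shows "heat t f x \<ge> 0"
  unfolding heat_def
  using poisson_mean_mono[of "\<lambda>k. 0" "\<lambda>k. (avg ^^ k) f x" t]
    bounded_funpow_avg(2)[OF assms(1)] funpow_avg_nonneg[of f] assms by simp

lemma abs_heat_le:
  assumes f: "\<And>y. \<bar>f y\<bar> \<le> C" and t: "t \<ge> 0"
  shows "\<bar>heat t f x\<bar> \<le> C"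
proof -
  have bounded: "bounded (range (\<lambda>k. (avg ^^ k) f x))"
    by (rule bounded_funpow_avg(2)[OF bounded_range_absI[OF f]])
  have "- C \<le> (avg ^^ k) f x" "(avg ^^ k) f x \<le> C" for k
    using abs_funpow_avg_le[of f C k x, OF f] by (auto simp: abs_le_iff)
  then show ?thesis
    using poisson_mean_mono[OF _ bounded, of "\<lambda>k. - C" t]
      poisson_mean_mono[OF bounded, of "\<lambda>k. C" t] t
    by (simp add: heat_def abs_le_iff)
qed

lemma bounded_heat:
  assumes "bounded (range f)" "t \<ge> 0"
  shows "bounded (range (heat t f))"
proof -
  obtain C where "\<And>y. \<bar>f y\<bar> \<le> C" using assms(1) by (rule bounded_range_absE) blast
  then show ?thesis by (rule bounded_range_absI[OF abs_heat_le[OF _ assms(2)]])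
qed

lemma avg_heat:
  assumes "bounded (range f)"
  shows "avg (heat t f) = heat t (avg f)"
proof
  fix x
  have "heat t (avg f) x = poisson_mean t (\<lambda>k. \<Sum>y | E x y. (1 / deg x) * (avg ^^ k) f y)"
    unfolding heat_def avg_funpow_avg by (simp add: avg_def sum_divide_distrib)
  also have "\<dots> = (\<Sum>y | E x y. poisson_mean t (\<lambda>k. (1 / deg x) * (avg ^^ k) f y))"
    using bounded_scaleR_comp[OF bounded_funpow_avg(2)[OF assms], of "1 / deg x"]
    by (intro poisson_mean_sum) simp
  also have "\<dots> = (\<Sum>y | E x y. (1 / deg x) * heat t f y)"
    unfolding heat_def by (intro sum.cong refl poisson_mean_cmult bounded_funpow_avg assms)
  finally show "avg (heat t f) x = heat t (avg f) x"
    by (simp add: avg_def sum_divide_distrib)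
qed

lemma DERIV_heat:
  assumes "bounded (range f)"
  shows "((\<lambda>t. heat t f x) has_real_derivative avg (heat t f) x - heat t f x) (at t)"
proof -
  have "avg (heat t f) x = poisson_mean t (\<lambda>k. (avg ^^ Suc k) f x)"
    unfolding avg_heat[OF assms] by (simp add: heat_def avg_funpow_avg)
  then show ?thesis
    using DERIV_poisson_mean[OF bounded_funpow_avg(2)[OF assms], of x t] by (simp add: heat_def)
qed

definition heat_subsolution :: "'a set \<Rightarrow> real \<Rightarrow> (real \<Rightarrow> 'a \<Rightarrow> real) \<Rightarrow> bool" where
  "heat_subsolution D T g \<longleftrightarrow> (\<forall>w\<in>D. \<forall>s\<in>{0..T}.
     \<exists>g'. ((\<lambda>s. g s w) has_real_derivative g') (at s) \<and> g' \<le> avg (g s) w - g s w)"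

lemma heat_subsolution_bound_Suc:
  assumes sub: "heat_subsolution D T g" and init: "\<And>w. w \<in> D \<Longrightarrow> g 0 w \<le> 0"
    and bdry: "\<And>s w y. w \<in> D \<Longrightarrow> E w y \<Longrightarrow> y \<notin> D \<Longrightarrow> s \<in> {0..T} \<Longrightarrow> g s y \<le> 0"
    and bound: "\<And>s w. w \<in> D \<Longrightarrow> s \<in> {0..T} \<Longrightarrow> exp s * g s w \<le> B * s ^ k / fact k"
    and B: "B \<ge> 0" and w: "w \<in> D" and s: "s \<in> {0..T}"
  shows "exp s * g s w \<le> B * s ^ Suc k / fact (Suc k)"
proof -
  define h where "h r = exp r * g r w - B * r ^ Suc k / fact (Suc k)" for r
  have "h s \<le> h 0"
  proof (rule DERIV_nonpos_imp_nonincreasing[of 0 s h])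
    fix r assume "0 \<le> r" "r \<le> s"
    then have r: "r \<in> {0..T}" using s by simp
    obtain g' where g': "((\<lambda>s. g s w) has_real_derivative g') (at r)" "g' \<le> avg (g r) w - g r w"
      using sub w r unfolding heat_subsolution_def by blast
    have power: "((\<lambda>r. B * r ^ Suc k / fact (Suc k)) has_real_derivative B * r ^ k / fact k) (at r)"
      using DERIV_cmult[OF DERIV_pow[of "Suc k" r], of "B / fact (Suc k)"]
      by (simp add: field_simps del: of_nat_Suc power_Suc)
    have "(h has_real_derivative exp r * (g' + g r w) - B * r ^ k / fact k) (at r)"
      unfolding h_def
      by (rule derivative_eq_intros g'(1) power refl | simp add: algebra_simps)+
    moreover have "exp r * (g' + g r w) \<le> avg (\<lambda>y. exp r * g r y) w"
      using g'(2) by (simp add: avg_cmult)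
    moreover have "avg (\<lambda>y. exp r * g r y) w \<le> B * r ^ k / fact k"
    proof (rule avg_le)
      show "exp r * g r y \<le> B * r ^ k / fact k" if "E w y" for y
      proof (cases "y \<in> D")
        case False
        then have "exp r * g r y \<le> 0" using bdry[OF w that _ r] by (simp add: mult_le_0_iff)
        also have "0 \<le> B * r ^ k / fact k" using B r by simp
        finally show ?thesis .
      qed (use bound r in blast)
    qed (use B r in simp)
    ultimately show "\<exists>h'. (h has_real_derivative h') (at r) \<and> h' \<le> 0"
      by (intro exI conjI) auto
  qed (use s in simp)
  also have "h 0 \<le> 0" using init[OF w] by (simp add: h_def)
  finally show ?thesis by (simp add: h_def)
qed

text \<open>An a priori bound \<open>B\<close> on \<open>exp s * g s w\<close> improves to \<open>B s\<^sup>k / k!\<close> for every \<open>k\<close>.\<close>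
lemma heat_subsolution_nonpos:
  assumes sub: "heat_subsolution D T g" and init: "\<And>w. w \<in> D \<Longrightarrow> g 0 w \<le> 0"
    and bdry: "\<And>s w y. w \<in> D \<Longrightarrow> E w y \<Longrightarrow> y \<notin> D \<Longrightarrow> s \<in> {0..T} \<Longrightarrow> g s y \<le> 0"
    and bound: "\<And>s w. w \<in> D \<Longrightarrow> s \<in> {0..T} \<Longrightarrow> g s w \<le> C"
    and w: "w \<in> D" and s: "s \<in> {0..T}"
  shows "g s w \<le> 0"
proof -
  define B where "B = \<bar>C\<bar> * exp T"
  have "exp s * g s w \<le> B * s ^ k / fact k" if "w \<in> D" "s \<in> {0..T}" for k w s
    using that
  proof (induction k arbitrary: w s)
    case 0
    have "exp s * g s w \<le> exp s * \<bar>C\<bar>" using bound[OF 0] by (intro mult_left_mono) auto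
    also have "\<dots> \<le> exp T * \<bar>C\<bar>" using 0 by (intro mult_right_mono) auto
    finally show ?case by (simp add: B_def mult.commute)
  next
    case (Suc k)
    show ?case
      by (rule heat_subsolution_bound_Suc[OF sub init bdry Suc.IH])
        (use Suc.prems in \<open>auto simp: B_def\<close>)
  qed
  moreover have "(\<lambda>k. B * (s ^ k / fact k)) \<longlonglongrightarrow> B * 0"
    using summable_exp[of s] by (intro tendsto_mult tendsto_const summable_LIMSEQ_zero)
      (simp add: divide_inverse mult.commute)
  ultimately have "exp s * g s w \<le> B * 0"
    by (intro LIMSEQ_le_const) (use w s in auto)
  then show ?thesis by (simp add: mult_le_0_iff)
qed

lemma heat_equation_unique:
  assumes g: "\<And>w s. s \<in> {0..T} \<Longrightarrow>
      ((\<lambda>s. g s w) has_real_derivative avg (g s) w - g s w) (at s)"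
    and h: "\<And>w s. s \<in> {0..T} \<Longrightarrow>
      ((\<lambda>s. h s w) has_real_derivative avg (h s) w - h s w) (at s)"
    and bounded: "\<And>w s. s \<in> {0..T} \<Longrightarrow> \<bar>g s w - h s w\<bar> \<le> C"
    and init: "\<And>w. g 0 w = h 0 w" and s: "s \<in> {0..T}"
  shows "g s x = h s x"
proof -
  have "a * (g s x - h s x) \<le> 0" if a: "a = 1 \<or> a = -1" for a
  proof (rule heat_subsolution_nonpos[where D = UNIV and T = T and C = C
        and g = "\<lambda>s w. a * (g s w - h s w)"])
    show "heat_subsolution UNIV T (\<lambda>s w. a * (g s w - h s w))"
      unfolding heat_subsolution_def avg_cmult avg_diff
      using DERIV_cmult[OF DERIV_diff[OF g h], where c = a]
      by (intro ballI exI conjI) (auto simp: algebra_simps)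
  qed (use bounded init s a in \<open>auto simp: abs_le_iff\<close>)
  from this[of 1] this[of "-1"] show ?thesis by simp
qed

lemma heat_semigroup:
  assumes f: "bounded (range f)" and s: "s \<ge> 0" and t: "t \<ge> 0"
  shows "heat s (heat t f) = heat (s + t) f"
proof -
  obtain C where C: "\<And>y. \<bar>f y\<bar> \<le> C" using f by (rule bounded_range_absE) blast
  show ?thesis
  proof (rule ext, rule heat_equation_unique[where
        g = "\<lambda>r. heat r (heat t f)" and h = "\<lambda>r. heat (r + t) f"])
    fix w r
    show "((\<lambda>r. heat r (heat t f) w) has_real_derivative
        avg (heat r (heat t f)) w - heat r (heat t f) w) (at r)"
      by (intro DERIV_heat bounded_heat f t)
    show "((\<lambda>r. heat (r + t) f w) has_real_derivative
        avg (heat (r + t) f) w - heat (r + t) f w) (at r)"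
      using DERIV_heat[OF f, of w "r + t"] by (simp add: DERIV_shift)
    assume r: "r \<in> {0..s}"
    then have "\<bar>heat r (heat t f) w\<bar> \<le> C" "\<bar>heat (r + t) f w\<bar> \<le> C"
      using t C by (auto intro: abs_heat_le)
    then show "\<bar>heat r (heat t f) w - heat (r + t) f w\<bar> \<le> 2 * C" by linarith
  qed (use s in auto)
qed

end

section \<open>Reversibility, energy and the heat kernel\<close>

context locally_finite_graph
begin

lemma has_sum_funpow_avg: "((\<lambda>w. (avg ^^ k) (point_mass w) x * f w) has_sum (avg ^^ k) f x) UNIV"
proof (induction k arbitrary: x)
  case 0
  show ?case by (rule has_sum_finite_neutralI[of "{x}"]) (auto simp: indicator_def)
next
  case (Suc k)
  have "((\<lambda>w. (\<Sum>y | E x y. (avg ^^ k) (point_mass w) y * f w) * (1 / deg x)) has_sum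
      (\<Sum>y | E x y. (avg ^^ k) f y) * (1 / deg x)) UNIV"
    by (intro has_sum_cmult_left has_sum_sum Suc)
  then show ?case by (simp add: avg_def[where x = x] sum_distrib_right)
qed

lemma has_sum_heat:
  assumes f: "bounded (range f)" and t: "t \<ge> 0"
  shows "((\<lambda>w. heat t (point_mass w) x * f w) has_sum heat t f x) UNIV"
proof -
  have nonneg: "((\<lambda>w. heat t (point_mass w) x * g w) has_sum heat t g x) UNIV"
    if g: "bounded (range g)" "\<And>w. g w \<ge> 0" for g
  proof -
    have "((\<lambda>w. poisson_mean t (\<lambda>k. (avg ^^ k) (point_mass w) x * g w)) has_sum heat t g x) UNIV"
      unfolding heat_def
      by (intro has_sum_poisson_mean has_sum_funpow_avg bounded_funpow_avg mult_nonneg_nonneg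
          funpow_avg_nonneg g t) simp
    moreover have "poisson_mean t (\<lambda>k. (avg ^^ k) (point_mass w) x * g w)
        = heat t (point_mass w) x * g w" for w
      using poisson_mean_cmult[OF bounded_funpow_avg(2), of "point_mass w" t "g w" x]
      by (simp add: heat_def bounded_range_absI[of _ 1] indicator_def mult.commute)
    ultimately show ?thesis by simp
  qed
  obtain C where C: "C \<ge> 0" "\<And>y. \<bar>f y\<bar> \<le> C" using f by (rule bounded_range_absE) blast
  have "bounded (range (\<lambda>w. f w + C))" using f by (intro bounded_plus_comp) auto
  moreover have "f w + C \<ge> 0" for w using C(2)[of w] by linarith
  ultimately have "((\<lambda>w. heat t (point_mass w) x * (f w + C) - heat t (point_mass w) x * C)
      has_sum heat t (\<lambda>w. f w + C) x - heat t (\<lambda>w. C) x) UNIV"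
    using C(1) by (intro has_sum_diff nonneg) auto
  then show ?thesis using heat_add[OF f, of "\<lambda>w. C"] by (simp add: algebra_simps)
qed

lemma avg_point_mass: "avg (point_mass y) w = (if E w y then 1 / deg w else 0)"
  using finite_nbrs[of w] by (simp add: avg_def indicator_def)

lemma funpow_avg_point_mass_reversible:
  "deg x * (avg ^^ k) (point_mass y) x = deg y * (avg ^^ k) (point_mass x) y"
proof (induction k arbitrary: x y)
  case 0
  show ?case by (simp add: indicator_def)
next
  case (Suc k)
  have "(avg ^^ Suc k) (point_mass y) x
      = (\<Sum>w | E y w. (avg ^^ k) (point_mass w) x * avg (point_mass y) w)"
  proof (rule has_sum_unique)
    show "((\<lambda>w. (avg ^^ k) (point_mass w) x * avg (point_mass y) w) has_sum
        (avg ^^ Suc k) (point_mass y) x) UNIV"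
      using has_sum_funpow_avg[of k x "avg (point_mass y)"] by (simp add: avg_funpow_avg)
  qed (auto intro!: has_sum_finite_neutralI[of "{w. E y w}"] finite_nbrs
      simp: avg_point_mass dest: E_sym split: if_splits)
  then have "deg x * (avg ^^ Suc k) (point_mass y) x
      = (\<Sum>w | E y w. deg x * (avg ^^ k) (point_mass w) x * (1 / deg w))"
    by (simp add: sum_distrib_left avg_point_mass E_sym mult.assoc)
  also have "\<dots> = (\<Sum>w | E y w. (avg ^^ k) (point_mass x) w)"
  proof (intro sum.cong refl)
    fix w assume "w \<in> {w. E y w}"
    then have "deg w > 0" using E_sym deg_pos_iff by blast
    then show "deg x * (avg ^^ k) (point_mass w) x * (1 / deg w) = (avg ^^ k) (point_mass x) w"
      using Suc[of x w] by simp
  qed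
  finally show ?case by (simp add: deg_mult_avg)
qed

lemma bounded_point_mass: "bounded (range (point_mass x))"
  by (rule bounded_range_absI[of _ 1]) (simp add: indicator_def)

lemma heat_point_mass_reversible:
  "deg x * heat t (point_mass y) x = deg y * heat t (point_mass x) y"
  unfolding heat_def
  by (simp add: poisson_mean_cmult[symmetric] bounded_funpow_avg bounded_point_mass
      funpow_avg_point_mass_reversible[of x])

lemma has_sum_heat_point_mass:
  assumes "bounded (range g)" "t \<ge> 0"
  shows "((\<lambda>w. deg w * heat t (point_mass z) w * g w) has_sum deg z * heat t g z) UNIV"
  using has_sum_cmult_right[OF has_sum_heat[OF assms, of z], of "deg z"]
  by (simp add: heat_point_mass_reversible[of z] flip: mult.assoc)

lemma bounded_restrict:
  assumes "bounded (range f)"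
  shows "bounded (range (\<lambda>w. indicator D w * f w :: real))"
proof -
  obtain C where "C \<ge> 0" "\<And>w. \<bar>f w\<bar> \<le> C" using assms by (rule bounded_range_absE) blast
  then show ?thesis by (intro bounded_range_absI[of _ C]) (auto simp: indicator_def)
qed

lemma heat_restrict_symmetric:
  assumes "t \<ge> 0"
  shows "deg x * heat t (\<lambda>w. indicator D w * heat t (point_mass y) w) x
       = deg y * heat t (\<lambda>w. indicator D w * heat t (point_mass x) w) y"
proof -
  have "((\<lambda>w. deg w * heat t (point_mass x) w * (indicator D w * heat t (point_mass y) w))
      has_sum deg x * heat t (\<lambda>w. indicator D w * heat t (point_mass y) w) x) UNIV" for x y
    using bounded_restrict[OF bounded_heat[OF bounded_point_mass assms]]
    by (rule has_sum_heat_point_mass[OF _ assms])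
  from this[of x y] this[of y x] show ?thesis
    by (auto simp: mult_ac intro: has_sum_unique)
qed

lemma sum_heat_point_mass_le_1:
  assumes "finite B" and t: "t \<ge> 0"
  shows "(\<Sum>w\<in>B. heat t (point_mass w) x) \<le> 1"
proof -
  have "((\<lambda>w. heat t (point_mass w) x * 1) has_sum heat t (\<lambda>w. 1) x) UNIV"
    by (intro has_sum_heat t) simp
  then have "(\<Sum>w\<in>B. heat t (point_mass w) x) \<le> heat t (\<lambda>w. 1) x"
    using assms heat_nonneg[OF bounded_point_mass] by (intro finite_sum_le_has_sum) auto
  also have "\<dots> \<le> 1" using abs_heat_le[of "\<lambda>w. 1" 1 t x] t by simp
  finally show ?thesis .
qed

lemma has_sum_square_edge_differences:
  fixes f :: "'a \<Rightarrow> real"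
  assumes square: "((\<lambda>w. deg w * (f w)\<^sup>2) has_sum a) UNIV"
    and avg: "((\<lambda>w. deg w * (f w * avg f w)) has_sum b) UNIV"
  shows "((\<lambda>(w, y). (f w - f y)\<^sup>2) has_sum 2 * (a - b)) {(w, y). E w y}"
proof -
  define edges where "edges = Sigma UNIV (\<lambda>w. {y. E w y})"
  have nbr_square: "((\<lambda>y. (f w)\<^sup>2) has_sum deg w * (f w)\<^sup>2) {y. E w y}" for w
    using finite_nbrs by (intro has_sum_finiteI) (auto simp: deg_def)
  have "(\<lambda>(w, y). (f w)\<^sup>2) summable_on edges"
    unfolding edges_def
    by (rule summable_on_SigmaI[where g = "\<lambda>w. deg w * (f w)\<^sup>2"])
      (use nbr_square square in \<open>auto intro: has_sum_imp_summable\<close>)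
  then have fst_square: "((\<lambda>(w, y). (f w)\<^sup>2) has_sum a) edges"
    unfolding edges_def using nbr_square square by (intro has_sum_SigmaI) auto
  have "bij_betw prod.swap edges edges"
    unfolding edges_def by (rule bij_betwI[where g = prod.swap]) (auto dest: E_sym)
  from has_sum_reindex_bij_betw[OF this, of "\<lambda>(w, y). (f w)\<^sup>2"] fst_square
  have snd_square: "((\<lambda>(w, y). (f y)\<^sup>2) has_sum a) edges"
    by (simp add: case_prod_unfold)
  have "\<bar>f w * f y\<bar> \<le> (f w)\<^sup>2 + (f y)\<^sup>2" for w y
  proof -
    have "2 * \<bar>f w * f y\<bar> \<le> (f w)\<^sup>2 + (f y)\<^sup>2"
      using sum_squares_bound[of "\<bar>f w\<bar>" "\<bar>f y\<bar>"] by (simp add: abs_mult mult.assoc)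
    then show ?thesis by linarith
  qed
  then have "(\<lambda>(w, y). f w * f y) summable_on edges"
    by (intro abs_summable_summable[OF Infinite_Sum.abs_summable_on_comparison_test'[OF
          has_sum_imp_summable[OF has_sum_add[OF fst_square snd_square]]]]) auto
  then have product: "((\<lambda>(w, y). f w * f y) has_sum b) edges"
    unfolding edges_def
    by (intro has_sum_SigmaI[OF _ avg])
      (auto simp: deg_mult_avg sum_distrib_left finite_nbrs mult.left_commute
        intro!: has_sum_finiteI)
  have "((\<lambda>e. (case e of (w, y) \<Rightarrow> (f w)\<^sup>2) + (case e of (w, y) \<Rightarrow> (f y)\<^sup>2)
      - 2 * (case e of (w, y) \<Rightarrow> f w * f y)) has_sum a + a - 2 * b) edges"
    by (intro has_sum_diff has_sum_add has_sum_cmult_right fst_square snd_square product)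
  moreover have "{(w, y). E w y} = edges" by (auto simp: edges_def)
  ultimately show ?thesis by (simp add: case_prod_unfold power2_diff algebra_simps)
qed

lemma sum_squares_simple_path_le:
  fixes f :: "'a \<Rightarrow> real"
  assumes edges: "((\<lambda>(w, y). (f w - f y)\<^sup>2) has_sum S) {(w, y). E w y}"
    and inj: "inj_on p {..n}" and path: "\<And>i. i < n \<Longrightarrow> E (p i) (p (Suc i))"
  shows "2 * (\<Sum>i<n. (f (p i) - f (p (Suc i)))\<^sup>2) \<le> S"
proof -
  define up where "up i = (p i, p (Suc i))" for i
  define down where "down i = (p (Suc i), p i)" for i
  have index_eq: "i = j" if "p i = p j" "i \<le> n" "j \<le> n" for i j
    using inj_onD[OF inj that(1)] that by simp
  have disjoint: "up ` {..<n} \<inter> down ` {..<n} = {}"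
  proof -
    have False if "i < n" "j < n" "p i = p (Suc j)" "p (Suc i) = p j" for i j
      using index_eq[of i "Suc j"] index_eq[of "Suc i" j] that by simp
    then show ?thesis by (auto simp: up_def down_def)
  qed
  have "2 * (\<Sum>i<n. (f (p i) - f (p (Suc i)))\<^sup>2)
      = (\<Sum>(w, y)\<in>up ` {..<n}. (f w - f y)\<^sup>2) + (\<Sum>(w, y)\<in>down ` {..<n}. (f w - f y)\<^sup>2)"
    by (subst (1 2) sum.reindex)
      (auto simp: up_def down_def power2_commute index_eq intro!: inj_onI)
  also have "\<dots> = (\<Sum>(w, y)\<in>up ` {..<n} \<union> down ` {..<n}. (f w - f y)\<^sup>2)"
    using disjoint by (intro sum.union_disjoint[symmetric]) auto
  also have "\<dots> \<le> S"
    by (rule finite_sum_le_has_sum[OF edges]) (auto simp: up_def down_def path E_sym)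
  finally show ?thesis .
qed

lemma square_diff_le_energy:
  fixes f :: "'a \<Rightarrow> real"
  assumes "((\<lambda>w. deg w * (f w)\<^sup>2) has_sum a) UNIV"
    and "((\<lambda>w. deg w * (f w * avg f w)) has_sum b) UNIV"
    and walk: "(E ^^ n) x y"
  shows "(f x - f y)\<^sup>2 \<le> real n * (a - b)"
proof -
  obtain p m where m: "m \<le> n" and p: "p 0 = x" "p m = y" "inj_on p {..m}"
      "\<And>i. i < m \<Longrightarrow> E (p i) (p (Suc i))"
    using walk by (rule relpowp_imp_simple_path) blast
  have energy: "(\<Sum>i<m. (f (p i) - f (p (Suc i)))\<^sup>2) \<le> a - b"
    using sum_squares_simple_path_le[OF has_sum_square_edge_differences[OF assms(1,2)] p(3,4)]
    by simp
  have "f x - f y = (\<Sum>i<m. 1 * (f (p i) - f (p (Suc i))))"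
    using sum_lessThan_telescope'[of "\<lambda>i. f (p i)" m] p by simp
  then have "(f x - f y)\<^sup>2 \<le> (\<Sum>i<m. 1\<^sup>2) * (\<Sum>i<m. (f (p i) - f (p (Suc i)))\<^sup>2)"
    by (simp only: Cauchy_Schwarz_ineq_sum)
  also have "\<dots> \<le> real m * (a - b)" using energy by (simp add: mult_left_mono)
  also have "\<dots> \<le> real n * (a - b)"
    using m order_trans[OF sum_nonneg energy] by (intro mult_right_mono) auto
  finally show ?thesis .
qed

definition heat_kernel :: "real \<Rightarrow> 'a \<Rightarrow> 'a \<Rightarrow> real" where
  "heat_kernel t x y = heat t (point_mass y) x / deg y"

definition dissipation :: "real \<Rightarrow> 'a \<Rightarrow> real" where
  "dissipation t z = heat_kernel t z z - avg (\<lambda>w. heat_kernel t w z) z"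

lemma heat_kernel_nonneg: "t \<ge> 0 \<Longrightarrow> heat_kernel t x y \<ge> 0"
  unfolding heat_kernel_def by (intro divide_nonneg_nonneg heat_nonneg bounded_point_mass) auto

lemma has_sum_heat_kernel:
  assumes x: "deg x > 0" and s: "s \<ge> 0" and t: "t \<ge> 0"
  shows "((\<lambda>w. deg w * (heat_kernel s w x * heat_kernel t w y))
    has_sum heat_kernel (s + t) x y) UNIV"
  using has_sum_cmult_right[OF has_sum_heat_point_mass[OF
        bounded_heat[OF bounded_point_mass t] s, of x y], of "1 / (deg x * deg y)"] x
  by (simp add: heat_kernel_def heat_semigroup[OF bounded_point_mass s t] mult_ac)

lemma has_sum_heat_kernel_avg:
  assumes z: "deg z > 0" and t: "t \<ge> 0"
  shows "((\<lambda>w. deg w * (heat_kernel t w z * avg (\<lambda>v. heat_kernel t v z) w)) has_sum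
    avg (\<lambda>w. heat_kernel (t + t) w z) z) UNIV"
proof -
  have avg_kernel: "avg (\<lambda>v. heat_kernel r v z) w = avg (heat r (point_mass z)) w / deg z" for r w
    using avg_cmult[of "1 / deg z" "heat r (point_mass z)"] by (simp add: heat_kernel_def)
  have "heat t (avg (heat t (point_mass z))) z = avg (heat (t + t) (point_mass z)) z"
    using t by (simp add: avg_heat bounded_heat bounded_avg bounded_point_mass heat_semigroup)
  then show ?thesis
    unfolding avg_kernel
    using has_sum_cmult_right[OF has_sum_heat_point_mass[OF
        bounded_avg[OF bounded_heat[OF bounded_point_mass t]] t, of z z], of "1 / (deg z)\<^sup>2"] z
    by (simp add: heat_kernel_def power2_eq_square mult_ac)
qed

lemma two_heat_kernel_le_diagonal:
  assumes "deg x > 0" "deg y > 0" and t: "t \<ge> 0"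
  shows "2 * heat_kernel t x y \<le> heat_kernel t x x + heat_kernel t y y"
proof (rule has_sum_mono)
  define h where "h v w = heat_kernel (t / 2) w v" for v w
  have half: "((\<lambda>w. deg w * (h v w * h v' w)) has_sum heat_kernel t v v') UNIV"
    if "deg v > 0" for v v'
    using has_sum_heat_kernel[OF that, of "t / 2" "t / 2" v'] t by (simp add: h_def)
  show "((\<lambda>w. 2 * (deg w * (h x w * h y w))) has_sum 2 * heat_kernel t x y) UNIV"
    by (intro has_sum_cmult_right half assms)
  show "((\<lambda>w. deg w * (h x w * h x w) + deg w * (h y w * h y w))
      has_sum heat_kernel t x x + heat_kernel t y y) UNIV"
    by (intro has_sum_add half assms)
  show "2 * (deg w * (h x w * h y w)) \<le> deg w * (h x w * h x w) + deg w * (h y w * h y w)" for w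
    using mult_left_mono[OF sum_squares_bound[of "h x w" "h y w"] deg_nonneg[of w]]
    by (simp add: power2_eq_square algebra_simps)
qed

lemma square_heat_kernel_diff_le_dissipation:
  assumes "deg z > 0" "t \<ge> 0" "(E ^^ n) x y"
  shows "(heat_kernel (t / 2) x z - heat_kernel (t / 2) y z)\<^sup>2 \<le> real n * dissipation t z"
  unfolding dissipation_def
  using has_sum_heat_kernel[of z "t / 2" "t / 2" z] has_sum_heat_kernel_avg[of z "t / 2"] assms
  by (intro square_diff_le_energy) (simp_all add: power2_eq_square)

lemma dissipation_nonneg:
  assumes "deg z > 0" "t \<ge> 0"
  shows "dissipation t z \<ge> 0"
proof -
  obtain y where "E z y" using assms deg_pos_iff by blast
  then have "(E ^^ 1) z y" by (simp add: eq_OO)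
  from square_heat_kernel_diff_le_dissipation[OF assms this] show ?thesis
    using order_trans[OF zero_le_power2] by simp
qed

lemma DERIV_heat_kernel_diagonal:
  "((\<lambda>t. heat_kernel t z z) has_real_derivative - dissipation t z) (at t)"
  using DERIV_cdivide[OF DERIV_heat[OF bounded_point_mass, of z z t], of "deg z"]
    avg_cmult[of "1 / deg z" "heat t (point_mass z)" z]
  by (simp add: heat_kernel_def dissipation_def diff_divide_distrib)

lemma heat_kernel_diagonal_antimono:
  assumes "deg z > 0" "0 \<le> s" "s \<le> t"
  shows "heat_kernel t z z \<le> heat_kernel s z z"
proof (rule DERIV_nonpos_imp_nonincreasing[OF assms(3)])
  fix r assume "s \<le> r"
  then show "\<exists>d. ((\<lambda>t. heat_kernel t z z) has_real_derivative d) (at r) \<and> d \<le> 0"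
    using DERIV_heat_kernel_diagonal[of z r] dissipation_nonneg[of z r] assms by force
qed

lemma sum_deg_heat_kernel_le_1:
  assumes "finite B" "t \<ge> 0"
  shows "(\<Sum>w\<in>B. deg w * heat_kernel t w z) \<le> 1"
proof (cases "deg z = 0")
  case False
  have "(\<Sum>w\<in>B. deg w * heat_kernel t w z) = (\<Sum>w\<in>B. heat t (point_mass w) z)"
    using False by (simp add: heat_kernel_def heat_point_mass_reversible[of _ t z])
  also have "\<dots> \<le> 1" by (rule sum_heat_point_mass_le_1[OF assms])
  finally show ?thesis .
qed (simp add: heat_kernel_def)

lemma exists_heat_kernel_le_inverse_volume:
  assumes B: "finite B" "(\<Sum>w\<in>B. deg w) > 0" and t: "t \<ge> 0"
  shows "\<exists>w\<in>B. heat_kernel t w z \<le> 1 / (\<Sum>w\<in>B. deg w)"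
proof -
  have "B \<noteq> {}" using B by auto
  then obtain w where w: "w \<in> B" "\<And>v. v \<in> B \<Longrightarrow> heat_kernel t w z \<le> heat_kernel t v z"
    using ex_min_if_finite[of "(\<lambda>w. heat_kernel t w z) ` B"] B by (force simp: not_less)
  have "(\<Sum>v\<in>B. deg v) * heat_kernel t w z \<le> (\<Sum>v\<in>B. deg v * heat_kernel t v z)"
    unfolding sum_distrib_right by (intro sum_mono mult_left_mono w) auto
  also have "\<dots> \<le> 1" by (rule sum_deg_heat_kernel_le_1[OF B(1) t])
  finally show ?thesis using w(1) B(2) by (auto simp: pos_le_divide_eq mult.commute)
qed

text \<open>As long as the diagonal value \<open>\<phi>\<close> exceeds \<open>2 / V\<close>, the kernel drops by half of it between \<open>z\<close>
  and some point of \<open>B\<close>, so the energy inequality gives \<open>\<phi>\<^sup>2 \<le> - 4 \<rho> \<phi>'\<close>.\<close>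
lemma heat_kernel_diagonal_le:
  assumes B: "finite B" "(\<Sum>w\<in>B. deg w) > 0"
    and near: "\<And>w. w \<in> B \<Longrightarrow> \<exists>n. real n \<le> \<rho> \<and> (E ^^ n) z w"
    and \<rho>: "\<rho> > 0" and s: "s > 0"
  shows "heat_kernel s z z \<le> max (2 / (\<Sum>w\<in>B. deg w)) (4 * \<rho> / s)"
proof (cases "heat_kernel s z z \<le> 2 / (\<Sum>w\<in>B. deg w)")
  case False
  define V where "V = (\<Sum>w\<in>B. deg w)"
  have V: "V > 0" using B by (simp add: V_def)
  have "deg z \<noteq> 0" using False V by (auto simp: heat_kernel_def V_def)
  then have z: "deg z > 0" by (simp add: less_le)
  have large: "2 / V < heat_kernel r z z" if "0 \<le> r" "r \<le> s" for r
    using heat_kernel_diagonal_antimono[OF z that] False by (simp add: V_def)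
  have "heat_kernel s z z \<le> 4 * \<rho> / s"
  proof (rule le_divide_of_square_le_deriv[where e = "\<lambda>r. dissipation r z"])
    fix r assume r: "0 \<le> r" "r \<le> s"
    show "((\<lambda>s. heat_kernel s z z) has_real_derivative - dissipation r z) (at r)"
      by (rule DERIV_heat_kernel_diagonal)
    have "0 < 2 / V" using V by simp
    then show pos: "0 < heat_kernel r z z" using large[OF r] by linarith
    obtain w where w: "w \<in> B" "heat_kernel (r / 2) w z \<le> 1 / V"
      using exists_heat_kernel_le_inverse_volume[OF B, of "r / 2" z] r by (auto simp: V_def)
    obtain n where n: "real n \<le> \<rho>" "(E ^^ n) z w" using near[OF w(1)] by blast
    have "heat_kernel r z z / 2 \<le> heat_kernel (r / 2) z z - heat_kernel (r / 2) w z"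
      using heat_kernel_diagonal_antimono[of z "r / 2" r] large[OF r] w(2) r z
      by (simp add: field_simps)
    then have "(heat_kernel r z z / 2)\<^sup>2 \<le> (heat_kernel (r / 2) z z - heat_kernel (r / 2) w z)\<^sup>2"
      using pos by (intro power_mono) auto
    also have "\<dots> \<le> real n * dissipation r z"
      by (rule square_heat_kernel_diff_le_dissipation[OF z r(1) n(2)])
    also have "\<dots> \<le> \<rho> * dissipation r z"
      by (intro mult_right_mono n dissipation_nonneg z r)
    finally show "(heat_kernel r z z)\<^sup>2 \<le> 4 * \<rho> * dissipation r z" by (simp add: power_divide)
  qed (use \<rho> s in auto)
  then show ?thesis by (rule max.coboundedI2)
qed (rule max.coboundedI1)

end

section \<open>Hitting times and the heat kernel\<close>

context locally_finite_graph
begin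

definition hitting_step :: "real \<Rightarrow> 'a \<Rightarrow> ('a \<Rightarrow> real) \<Rightarrow> 'a \<Rightarrow> real" where
  "hitting_step \<theta> z f w = (if w = z then 1 else avg f w / (1 + \<theta>))"

text \<open>With \<open>T\<close> the time at which the jump chain hits \<open>z\<close>, the \<open>k\<close>-th iterate is the expectation
  of \<open>(1 + \<theta>) powr - min T k\<close>, and the limit is the Laplace transform at \<open>\<theta>\<close> of the hitting time
  of \<open>z\<close> by the continuous-time walk.\<close>
definition hitting_laplace :: "real \<Rightarrow> 'a \<Rightarrow> 'a \<Rightarrow> real" where
  "hitting_laplace \<theta> z w = lim (\<lambda>k. (hitting_step \<theta> z ^^ k) (\<lambda>_. 1) w)"

lemma hitting_laplace:
  assumes \<theta>: "\<theta> > 0"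
  shows hitting_laplace_nonneg: "0 \<le> hitting_laplace \<theta> z w"
    and hitting_laplace_le_1: "hitting_laplace \<theta> z w \<le> 1"
    and hitting_laplace_self: "hitting_laplace \<theta> z z = 1"
    and avg_hitting_laplace:
      "w \<noteq> z \<Longrightarrow> avg (hitting_laplace \<theta> z) w = (1 + \<theta>) * hitting_laplace \<theta> z w"
proof -
  define a where "a k = (hitting_step \<theta> z ^^ k) (\<lambda>_. 1)" for k
  have a_Suc: "a (Suc k) w = hitting_step \<theta> z (a k) w" for k w by (simp add: a_def)
  have a_nonneg: "0 \<le> a k w" for k w
    by (induction k arbitrary: w)
      (use \<theta> in \<open>auto simp: a_def hitting_step_def intro!: divide_nonneg_nonneg avg_nonneg\<close>)
  have a_antimono: "a (Suc k) w \<le> a k w" for k w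
  proof (induction k arbitrary: w)
    case 0
    have "avg (\<lambda>_. 1) w \<le> 1" by (rule avg_le) auto
    then show ?case using \<theta> by (auto simp: a_def hitting_step_def)
  next
    case (Suc k)
    then show ?case using \<theta> unfolding a_Suc[of "Suc k"] a_Suc[of k]
      by (auto simp: hitting_step_def intro!: divide_right_mono avg_mono)
  qed
  have decseq: "decseq (\<lambda>k. a k w)" for w using a_antimono by (simp add: decseq_Suc_iff)
  have lim: "(\<lambda>k. a k w) \<longlonglongrightarrow> hitting_laplace \<theta> z w" for w
    unfolding hitting_laplace_def a_def[symmetric]
    using decseq_convergent[OF decseq[of w], of 0] a_nonneg by (metis limI)
  have lim_step: "(\<lambda>k. hitting_step \<theta> z (a k) w) \<longlonglongrightarrow> hitting_laplace \<theta> z w" for w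
    using LIMSEQ_Suc[OF lim[of w]] unfolding a_Suc .
  show "0 \<le> hitting_laplace \<theta> z w" using LIMSEQ_le_const[OF lim] a_nonneg by blast
  show "hitting_laplace \<theta> z w \<le> 1"
    using decseq_ge[OF decseq lim, of w 0] by (simp add: a_def)
  show "hitting_laplace \<theta> z z = 1"
    using lim_step[of z] by (simp add: hitting_step_def LIMSEQ_const_iff)
  show "avg (hitting_laplace \<theta> z) w = (1 + \<theta>) * hitting_laplace \<theta> z w" if "w \<noteq> z"
  proof -
    have "(\<lambda>k. hitting_step \<theta> z (a k) w) \<longlonglongrightarrow> avg (hitting_laplace \<theta> z) w / (1 + \<theta>)"
      unfolding hitting_step_def avg_def[where x = w] divide_inverse using that
      by (auto intro!: tendsto_intros lim)
    then have "hitting_laplace \<theta> z w = avg (hitting_laplace \<theta> z) w / (1 + \<theta>)"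
      using LIMSEQ_unique[OF lim_step] by blast
    then show ?thesis using \<theta> by simp
  qed
qed

lemma killed_max_principle:
  assumes \<theta>: "\<theta> > 0" and b: "b \<ge> 0" and bounded: "\<And>w. w \<in> D \<Longrightarrow> u w \<le> C"
    and sub: "\<And>w. w \<in> D \<Longrightarrow> (1 + \<theta>) * u w \<le> avg u w"
    and bdry: "\<And>w y. w \<in> D \<Longrightarrow> E w y \<Longrightarrow> y \<notin> D \<Longrightarrow> u y \<le> b"
    and w: "w \<in> D"
  shows "u w \<le> b"
proof -
  define s where "s = max b (SUP v\<in>D. u v)"
  have "bdd_above (u ` D)" using bounded by (rule bdd_aboveI2)
  then have le_s: "u v \<le> s" if "v \<in> D" for v
    unfolding s_def using that by (intro max.coboundedI2 cSUP_upper)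
  have "u v \<le> s / (1 + \<theta>)" if "v \<in> D" for v
  proof -
    have "avg u v \<le> s"
    proof (rule avg_le)
      show "u y \<le> s" if "E v y" for y
        using bdry[OF \<open>v \<in> D\<close> that] le_s by (cases "y \<in> D") (auto simp: s_def)
    qed (use b in \<open>simp add: s_def\<close>)
    then have "(1 + \<theta>) * u v \<le> s" using sub[OF that] by linarith
    then show ?thesis using \<theta> by (simp add: pos_le_divide_eq mult.commute)
  qed
  then have "(SUP v\<in>D. u v) \<le> s / (1 + \<theta>)" using w by (intro cSUP_least) auto
  moreover have "s / (1 + \<theta>) < s" if "s > b"
    using that b \<theta> by (simp add: pos_divide_less_eq)
  ultimately have "s = b" by (fastforce simp: s_def max_def split: if_splits)
  then show ?thesis using le_s[OF w] by simp
qed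

definition separates :: "'a \<Rightarrow> 'a set \<Rightarrow> bool" where
  "separates z D \<longleftrightarrow> z \<notin> D \<and> (\<forall>w\<in>D. \<forall>y. E w y \<longrightarrow> y \<in> D \<or> y = z)"

lemma separates_Compl: "separates z D \<Longrightarrow> separates z (- D - {z})"
  unfolding separates_def using E_sym by blast

lemma heat_le_hitting_laplace:
  assumes \<theta>: "\<theta> > 0" and D: "separates z D" and h: "bounded (range h)"
    and nonpos: "\<And>w. w \<in> D \<Longrightarrow> h w \<le> 0"
    and K: "K \<ge> 0" "\<And>s. s \<in> {0..T} \<Longrightarrow> heat s h z \<le> K"
    and w: "w \<in> D" and T: "T \<ge> 0"
  shows "heat T h w \<le> K * exp (\<theta> * T) * hitting_laplace \<theta> z w"
proof -
  note laplace = hitting_laplace[OF \<theta>, where z = z]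
  define g where "g s w = heat s h w - K * exp (\<theta> * s) * hitting_laplace \<theta> z w" for s w
  have laplace_term_nonneg: "0 \<le> K * exp (\<theta> * s) * hitting_laplace \<theta> z v" for s v
    using K laplace by simp
  obtain C where C: "\<And>w. \<bar>h w\<bar> \<le> C" using h by (rule bounded_range_absE) blast
  have "g T w \<le> 0"
  proof (rule heat_subsolution_nonpos[where D = D and T = T and C = C and g = g])
    show "heat_subsolution D T g"
      unfolding heat_subsolution_def
    proof (intro ballI exI conjI)
      fix v s assume "v \<in> D"
      then have "v \<noteq> z" using D by (auto simp: separates_def)
      then have avg: "avg (g s) v = avg (heat s h) v
          - K * exp (\<theta> * s) * ((1 + \<theta>) * hitting_laplace \<theta> z v)"
        unfolding g_def avg_diff avg_cmult by (simp add: laplace)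
      show "((\<lambda>s. g s v) has_real_derivative avg (g s) v - g s v) (at s)"
        unfolding avg unfolding g_def
        by (rule derivative_eq_intros DERIV_heat[OF h] refl | simp add: algebra_simps)+
    qed simp
  next
    fix v assume "v \<in> D"
    then show "g 0 v \<le> 0" using nonpos[of v] laplace_term_nonneg[of 0 v] by (simp add: g_def)
  next
    fix s v y assume "v \<in> D" "E v y" "y \<notin> D" and s: "s \<in> {0..T}"
    then have "y = z" using D by (auto simp: separates_def)
    moreover have "K * 1 \<le> K * exp (\<theta> * s)" using K \<theta> s by (intro mult_left_mono) auto
    ultimately show "g s y \<le> 0" using K(2)[OF s] laplace by (simp add: g_def)
  next
    fix s v assume "s \<in> {0..T}"
    then have "heat s h v \<le> C" using abs_heat_le[of h C s v] C by (auto simp: abs_le_iff)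
    then show "g s v \<le> C" using laplace_term_nonneg[of s v] by (simp add: g_def)
  qed (use w T in auto)
  then show ?thesis by (simp add: g_def)
qed

lemma heat_restrict_le_hitting_laplace:
  assumes \<theta>: "\<theta> > 0" and D: "separates z D" and w: "w \<in> D" and A: "D \<inter> A = {}"
    and v: "deg v > 0" and s: "s \<ge> 0"
    and K: "\<And>r. s \<le> r \<Longrightarrow> r \<le> 2 * s \<Longrightarrow> heat_kernel r z v \<le> K"
  shows "heat s (\<lambda>w. indicator A w * heat s (point_mass v) w) w / deg v
    \<le> K * exp (\<theta> * s) * hitting_laplace \<theta> z w"
proof -
  have bounded: "bounded (range (heat s (point_mass v)))"
    by (intro bounded_heat bounded_point_mass s)
  have "heat s (\<lambda>w. indicator A w * heat s (point_mass v) w) w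
      \<le> (K * deg v) * exp (\<theta> * s) * hitting_laplace \<theta> z w"
  proof (rule heat_le_hitting_laplace[OF \<theta> D bounded_restrict[OF bounded]])
    show "indicator A y * heat s (point_mass v) y \<le> 0" if "y \<in> D" for y
      using that A by (auto simp: indicator_def disjoint_iff)
    have "0 \<le> K" using K[of s] heat_kernel_nonneg[OF s, of z v] s by force
    then show "0 \<le> K * deg v" by simp
    fix r assume r: "r \<in> {0..s}"
    have "indicator A y * heat s (point_mass v) y \<le> heat s (point_mass v) y" for y
      using heat_nonneg[OF bounded_point_mass _ s, of v y] by (simp add: indicator_def)
    then have "heat r (\<lambda>w. indicator A w * heat s (point_mass v) w) z
        \<le> heat r (heat s (point_mass v)) z"
      using r by (intro heat_mono bounded_restrict bounded) auto
    also have "\<dots> = heat_kernel (r + s) z v * deg v"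
      using r s v by (simp add: heat_semigroup bounded_point_mass heat_kernel_def)
    also have "\<dots> \<le> K * deg v" using K[of "r + s"] r s by (intro mult_right_mono) auto
    finally show "heat r (\<lambda>w. indicator A w * heat s (point_mass v) w) z \<le> K * deg v" .
  qed (use w s in auto)
  then show ?thesis using v by (simp add: field_simps)
qed

text \<open>Split the walk from \<open>x\<close> to \<open>y\<close> at time \<open>t / 2\<close> according to the side of \<open>z\<close> it is on. On the
  part that is already across, the walk from \<open>x\<close> has passed \<open>z\<close> before \<open>t / 2\<close>; on the other part,
  by reversibility, so has the walk from \<open>y\<close>.\<close>
lemma heat_kernel_le_hitting_laplace:
  assumes \<theta>: "\<theta> > 0" and D: "separates z D" and x: "x \<in> D" and y: "y \<notin> D" "y \<noteq> z"
    and deg: "deg x > 0" "deg y > 0" and t: "t \<ge> 0"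
    and K: "\<And>s v. t / 2 \<le> s \<Longrightarrow> s \<le> t \<Longrightarrow> v \<in> {x, y} \<Longrightarrow> heat_kernel s z v \<le> K"
  shows "heat_kernel t x y \<le> K * exp (\<theta> * t) * (hitting_laplace \<theta> z x + hitting_laplace \<theta> z y)"
proof -
  define s where "s = t / 2"
  have s: "s \<ge> 0" "s + s = t" using t by (auto simp: s_def)
  have bounded: "bounded (range (\<lambda>w. indicator A w * heat s (point_mass v) w))" for A v
    by (intro bounded_restrict bounded_heat bounded_point_mass s)
  have "heat t (point_mass y) x = heat s (heat s (point_mass y)) x"
    using heat_semigroup[OF bounded_point_mass s(1) s(1)] s(2) by simp
  also have "heat s (point_mass y)
      = (\<lambda>w. indicator (- D) w * heat s (point_mass y) w + indicator D w * heat s (point_mass y) w)"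
    by (auto simp: indicator_def)
  also have "heat s \<dots> x = heat s (\<lambda>w. indicator (- D) w * heat s (point_mass y) w) x
      + heat s (\<lambda>w. indicator D w * heat s (point_mass y) w) x"
    by (rule heat_add[OF bounded bounded])
  finally have "heat_kernel t x y
      = heat s (\<lambda>w. indicator (- D) w * heat s (point_mass y) w) x / deg y
      + heat s (\<lambda>w. indicator D w * heat s (point_mass x) w) y / deg x"
    using heat_restrict_symmetric[OF s(1), of x D y] deg by (simp add: heat_kernel_def field_simps)
  also have "\<dots> \<le> K * exp (\<theta> * s) * hitting_laplace \<theta> z x + K * exp (\<theta> * s) * hitting_laplace \<theta> z y"
  proof (intro add_mono)
    show "heat s (\<lambda>w. indicator (- D) w * heat s (point_mass y) w) x / deg y
        \<le> K * exp (\<theta> * s) * hitting_laplace \<theta> z x"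
      by (rule heat_restrict_le_hitting_laplace[OF \<theta> D x]) (use deg s K in \<open>auto simp: s_def\<close>)
    show "heat s (\<lambda>w. indicator D w * heat s (point_mass x) w) y / deg x
        \<le> K * exp (\<theta> * s) * hitting_laplace \<theta> z y"
      by (rule heat_restrict_le_hitting_laplace[OF \<theta> separates_Compl[OF D]])
        (use y deg s K in \<open>auto simp: s_def\<close>)
  qed
  also have "\<dots> = K * exp (\<theta> * s) * (hitting_laplace \<theta> z x + hitting_laplace \<theta> z y)"
    by (simp add: distrib_left)
  also have "\<dots> \<le> K * exp (\<theta> * t) * (hitting_laplace \<theta> z x + hitting_laplace \<theta> z y)"
    using K[of t x] heat_kernel_nonneg[OF t, of z x] hitting_laplace_nonneg[OF \<theta>, of z] \<theta> t
    by (intro mult_right_mono mult_left_mono add_nonneg_nonneg) (auto simp: s_def)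
  finally show ?thesis .
qed

end

section \<open>Rooted trees\<close>

locale rooted_tree = locally_finite_graph E for E :: "'a \<Rightarrow> 'a \<Rightarrow> bool" +
  fixes V :: "'a set" and rt :: 'a and parent :: "'a \<Rightarrow> 'a" and depth :: "'a \<Rightarrow> nat"
  assumes rt_in: "rt \<in> V"
    and depth_rt: "depth rt = 0"
    and parent_nbr: "w \<in> V \<Longrightarrow> w \<noteq> rt \<Longrightarrow> E w (parent w)"
    and depth_parent: "w \<in> V \<Longrightarrow> w \<noteq> rt \<Longrightarrow> depth w = Suc (depth (parent w))"
    and nbr_in: "w \<in> V \<Longrightarrow> E w y \<Longrightarrow> y \<in> V"
    and nbr_cases: "w \<in> V \<Longrightarrow> E w y \<Longrightarrow> w \<noteq> rt \<and> y = parent w \<or> y \<noteq> rt \<and> parent y = w"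
begin

definition desc :: "'a \<Rightarrow> 'a set" where
  "desc c = {w \<in> V. \<exists>i \<le> depth w. (parent ^^ i) w = c}"

definition children :: "'a \<Rightarrow> 'a set" where
  "children c = {y \<in> V. y \<noteq> rt \<and> parent y = c}"

lemma parent_in: "w \<in> V \<Longrightarrow> w \<noteq> rt \<Longrightarrow> parent w \<in> V"
  using parent_nbr nbr_in by blast

lemma parent_pow:
  assumes "w \<in> V" "i \<le> depth w"
  shows "(parent ^^ i) w \<in> V \<and> depth ((parent ^^ i) w) = depth w - i"
  using assms(2)
proof (induction i)
  case (Suc i)
  then have "(parent ^^ i) w \<in> V" "depth ((parent ^^ i) w) = depth w - i" by auto
  moreover from this have "(parent ^^ i) w \<noteq> rt" using Suc.prems depth_rt by auto
  ultimately show ?case using parent_in depth_parent[of "(parent ^^ i) w"] by simp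
qed (simp add: assms)

lemma parent_pow_ne_rt: "w \<in> V \<Longrightarrow> i < depth w \<Longrightarrow> (parent ^^ i) w \<noteq> rt"
  using parent_pow[of w i] depth_rt by auto

lemma walk_parent_pow:
  assumes "w \<in> V" "i \<le> depth w"
  shows "(E ^^ i) w ((parent ^^ i) w)"
  using assms(2)
proof (induction i)
  case (Suc i)
  then have "E ((parent ^^ i) w) (parent ((parent ^^ i) w))"
    using parent_pow[OF assms(1)] parent_pow_ne_rt[OF assms(1)] by (intro parent_nbr) auto
  with Suc show ?case by auto
qed simp

lemma parent_pow_desc: "w \<in> V \<Longrightarrow> i \<le> depth w \<Longrightarrow> w \<in> desc ((parent ^^ i) w)"
  by (auto simp: desc_def)

lemma desc_self: "c \<in> V \<Longrightarrow> c \<in> desc c"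
  using parent_pow_desc[of c 0] by simp

lemma descD:
  assumes "w \<in> desc c"
  shows "w \<in> V" "c \<in> V" "depth c \<le> depth w" "(parent ^^ (depth w - depth c)) w = c"
  using assms parent_pow by (auto simp: desc_def)

lemma desc_trans:
  assumes "a \<in> desc b" "b \<in> desc c"
  shows "a \<in> desc c"
proof -
  define i j where "i = depth a - depth b" and "j = depth b - depth c"
  have "(parent ^^ (j + i)) a = (parent ^^ j) ((parent ^^ i) a)"
    by (simp only: funpow_add comp_apply)
  also have "\<dots> = c" using descD(4)[OF assms(1)] descD(4)[OF assms(2)] by (simp add: i_def j_def)
  finally have "(parent ^^ (j + i)) a = c" .
  moreover have "j + i \<le> depth a"
    using descD(3)[OF assms(1)] by (simp add: i_def j_def)
  ultimately show ?thesis using parent_pow_desc[OF descD(1)[OF assms(1)]] by blast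
qed

lemma desc_eq: "w \<in> desc a \<Longrightarrow> w \<in> desc b \<Longrightarrow> depth a = depth b \<Longrightarrow> a = b"
  by (metis descD(4))

lemma rt_desc_iff: "rt \<in> desc c \<longleftrightarrow> c = rt"
  using rt_in depth_rt by (auto simp: desc_def)

lemma desc_rt: "w \<in> V \<Longrightarrow> w \<in> desc rt"
  using parent_pow_desc[of w "depth w"] parent_pow[of w "depth w"] depth_parent by fastforce

lemma child_desc: "y \<in> children c \<Longrightarrow> y \<in> desc c"
  using parent_pow_desc[of y 1] depth_parent[of y] by (auto simp: children_def)

lemma depth_child: "y \<in> children c \<Longrightarrow> depth y = Suc (depth c)"
  using depth_parent by (auto simp: children_def)

lemma desc_child_cases:
  assumes "w \<in> desc c" "w \<noteq> c"
  obtains y where "y \<in> children c" "w \<in> desc y"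
proof -
  obtain i where i: "i \<le> depth w" "(parent ^^ i) w = c" using assms(1) by (auto simp: desc_def)
  with assms obtain j where j: "i = Suc j" by (cases i) auto
  have w: "w \<in> V" using assms(1) by (rule descD)
  have "(parent ^^ j) w \<in> children c"
    using i j parent_pow[OF w, of j] parent_pow_ne_rt[OF w, of j] by (auto simp: children_def)
  moreover have "w \<in> desc ((parent ^^ j) w)" using w i j by (intro parent_pow_desc) auto
  ultimately show ?thesis by (rule that)
qed

lemma desc_eq_children:
  assumes "c \<in> V"
  shows "desc c = insert c (\<Union>y\<in>children c. desc y)"
proof
  show "desc c \<subseteq> insert c (\<Union>y\<in>children c. desc y)" by (blast elim: desc_child_cases)
  show "insert c (\<Union>y\<in>children c. desc y) \<subseteq> desc c"
    using desc_self[OF assms] desc_trans[OF _ child_desc] by blast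
qed

lemma nbr_desc:
  assumes "w \<in> desc c" "E w y"
  shows "y \<in> desc c \<or> w = c \<and> c \<noteq> rt \<and> y = parent c"
proof -
  from nbr_cases[OF descD(1)[OF assms(1)] assms(2)] show ?thesis
  proof (elim disjE conjE)
    assume y: "w \<noteq> rt" "y = parent w"
    show ?thesis
    proof (cases "w = c")
      case False
      obtain i where i: "i \<le> depth w" "(parent ^^ i) w = c" using assms(1) by (auto simp: desc_def)
      with False obtain j where "i = Suc j" by (cases i) auto
      then have "(parent ^^ j) y = c" "j \<le> depth y"
        using i y depth_parent[of w] descD(1)[OF assms(1)] by (auto simp: funpow_swap1)
      then show ?thesis
        using parent_pow_desc[of y j] nbr_in[OF descD(1)[OF assms(1)] assms(2)] by simp
    qed (use y in simp)
  next
    assume "y \<noteq> rt" "parent y = w"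
    then have "y \<in> children w"
      using nbr_in[OF descD(1)[OF assms(1)] assms(2)] by (simp add: children_def)
    then show ?thesis using desc_trans[OF child_desc assms(1)] by blast
  qed
qed

lemma separates_desc: "c \<in> V \<Longrightarrow> c \<noteq> rt \<Longrightarrow> parent c = z \<Longrightarrow> separates z (desc c)"
  unfolding separates_def using nbr_desc depth_parent[of c] descD(3)[of z c] by fastforce

lemma children_nbr: "y \<in> children c \<Longrightarrow> E c y"
  using parent_nbr E_sym by (auto simp: children_def)

lemma nbrs_eq:
  assumes "c \<in> V" "c \<noteq> rt"
  shows "{y. E c y} = insert (parent c) (children c)" "parent c \<notin> children c"
proof -
  show "{y. E c y} = insert (parent c) (children c)"
  proof
    show "{y. E c y} \<subseteq> insert (parent c) (children c)"
      using nbr_cases[OF assms(1)] nbr_in[OF assms(1)] by (auto simp: children_def)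
    show "insert (parent c) (children c) \<subseteq> {y. E c y}"
      using parent_nbr[OF assms] children_nbr by auto
  qed
  show "parent c \<notin> children c"
    using depth_child[of "parent c" c] depth_parent[OF assms] by auto
qed

lemma finite_children: "finite (children c)"
  by (rule finite_subset[OF _ finite_nbrs[of c]]) (auto intro: children_nbr)

lemma sum_desc:
  fixes f :: "'a \<Rightarrow> real"
  assumes T: "finite T" and c: "c \<in> V"
  shows "sum f (T \<inter> desc c) = (if c \<in> T then f c else 0) + (\<Sum>y\<in>children c. sum f (T \<inter> desc y))"
proof -
  have not_below: "c \<notin> (\<Union>y\<in>children c. desc y)"
    using descD(3)[of c] depth_child by fastforce
  have "T \<inter> desc c = (T \<inter> {c}) \<union> (\<Union>y\<in>children c. T \<inter> desc y)"
    using desc_eq_children[OF c] by blast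
  then have "sum f (T \<inter> desc c) = sum f (T \<inter> {c}) + sum f (\<Union>y\<in>children c. T \<inter> desc y)"
    using T not_below by (simp add: finite_children sum.union_disjoint disjoint_iff)
  also have "sum f (\<Union>y\<in>children c. T \<inter> desc y) = (\<Sum>y\<in>children c. sum f (T \<inter> desc y))"
    using T desc_eq depth_child by (intro sum.UNION_disjoint finite_children) fastforce+
  also have "sum f (T \<inter> {c}) = (if c \<in> T then f c else 0)" by simp
  finally show ?thesis .
qed

lemma subtree_induct [consumes 2, case_names empty children]:
  assumes "finite T" "c \<in> V"
    and empty: "\<And>c. c \<in> V \<Longrightarrow> T \<inter> desc c = {} \<Longrightarrow> P c"
    and children: "\<And>c. c \<in> V \<Longrightarrow> (\<And>y. y \<in> children c \<Longrightarrow> P y) \<Longrightarrow> P c"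
  shows "P c"
proof -
  have "P c" if "c \<in> V" "\<forall>w\<in>T. depth w < depth c + n" for n
    using that
  proof (induction n arbitrary: c)
    case 0
    then show ?case using descD(3)[of _ c] by (intro empty) fastforce+
  next
    case (Suc n)
    show ?case
    proof (rule children[OF Suc.prems(1)])
      fix y assume "y \<in> children c"
      then show "P y" using Suc depth_child[of y c] by (auto simp: children_def)
    qed
  qed
  moreover have "\<forall>w\<in>T. depth w < depth c + Suc (Max (depth ` T))"
    using assms(1) by (auto simp: less_Suc_eq_le trans_le_add2)
  ultimately show ?thesis using assms(2) by blast
qed

lemma walk_desc:
  assumes "z \<in> V" "(E ^^ m) z w" "m \<le> depth z"
  shows "w \<in> desc ((parent ^^ m) z)"
  using assms(2,3)
proof (induction m arbitrary: w)
  case 0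
  then show ?case using assms desc_self by simp
next
  case (Suc m)
  then obtain v where v: "(E ^^ m) z v" "E v w" by auto
  have top: "(parent ^^ m) z \<in> V" "depth ((parent ^^ m) z) = depth z - m"
    using parent_pow[OF assms(1), of m] Suc.prems by auto
  have up: "(parent ^^ m) z \<in> desc ((parent ^^ Suc m) z)"
    using parent_pow_desc[OF top(1), of 1] top(2) Suc.prems by simp
  have "v \<in> desc ((parent ^^ m) z)" using Suc v by simp
  then consider "w \<in> desc ((parent ^^ m) z)" | "w = (parent ^^ Suc m) z"
    using nbr_desc[OF _ v(2)] by auto
  then show ?case
  proof cases
    case 1
    then show ?thesis using up by (rule desc_trans)
  next
    case 2
    then show ?thesis using desc_self parent_pow[OF assms(1) Suc.prems(2)] by simp
  qed
qed

lemma walk_desc_pow: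
  assumes z: "z \<in> V" and walk: "(E ^^ m) z w" and k: "m \<le> k" "k \<le> depth z"
  shows "w \<in> desc ((parent ^^ k) z)"
proof (rule desc_trans)
  show "w \<in> desc ((parent ^^ m) z)" using walk_desc[OF z walk] k by simp
  have "(parent ^^ k) z = (parent ^^ (k - m)) ((parent ^^ m) z)"
    using k(1) funpow_add[of "k - m" m parent] by simp
  then show "(parent ^^ m) z \<in> desc ((parent ^^ k) z)"
    using parent_pow_desc[of "(parent ^^ m) z" "k - m"] parent_pow[OF z, of m] k by simp
qed

end

section \<open>Decay of hitting probabilities on a tree\<close>

locale killed_tree = rooted_tree +
  fixes \<theta> :: real
  assumes theta_pos: "\<theta> > 0"
begin

abbreviation u :: "'a \<Rightarrow> real" where "u \<equiv> hitting_laplace \<theta> rt"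

definition flux :: "'a \<Rightarrow> real" where "flux w = u (parent w) - u w"

lemmas u_nonneg [simp] = hitting_laplace_nonneg[OF theta_pos, where z = rt]

lemma flux_eq:
  assumes "w \<in> V" "w \<noteq> rt"
  shows "flux w = \<theta> * (deg w * u w) + (\<Sum>y\<in>children w. flux y)"
proof -
  have "(\<Sum>y | E w y. u y) = deg w * ((1 + \<theta>) * u w)"
    using deg_mult_avg[of w u] avg_hitting_laplace[OF theta_pos assms(2)] by simp
  moreover have "(\<Sum>y | E w y. u y) = u (parent w) + (\<Sum>y\<in>children w. u y)"
    using nbrs_eq[OF assms] finite_children by simp
  moreover have "deg w = 1 + real (card (children w))"
    unfolding deg_def using nbrs_eq[OF assms] finite_children by simp
  moreover have "(\<Sum>y\<in>children w. flux y) = real (card (children w)) * u w - (\<Sum>y\<in>children w. u y)"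
    by (simp add: flux_def children_def sum_subtractf)
  ultimately show ?thesis by (simp add: flux_def algebra_simps)
qed

lemma flux_nonneg:
  assumes "w \<in> V" "w \<noteq> rt"
  shows "flux w \<ge> 0"
proof -
  have "u w \<le> u (parent w)"
  proof (rule killed_max_principle[OF theta_pos, where D = "desc w" and C = 1])
    fix v assume v: "v \<in> desc w"
    then have "v \<noteq> rt" using assms rt_desc_iff[of w] by blast
    then show "(1 + \<theta>) * u v \<le> avg u v" by (simp add: avg_hitting_laplace[OF theta_pos])
    show "u y \<le> u (parent w)" if "E v y" "y \<notin> desc w" for y
      using nbr_desc[OF v that(1)] that(2) by auto
  qed (use assms desc_self hitting_laplace_le_1[OF theta_pos, of rt] in auto)
  then show ?thesis by (simp add: flux_def)
qed

lemma flux_child_le: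
  assumes "y \<in> children w" "w \<in> V" "w \<noteq> rt"
  shows "flux y \<le> flux w"
proof -
  have "flux y \<le> (\<Sum>y\<in>children w. flux y)"
    using assms(1) flux_nonneg by (intro member_le_sum finite_children) (auto simp: children_def)
  also have "\<dots> \<le> flux w" using flux_eq[OF assms(2,3)] theta_pos by simp
  finally show ?thesis .
qed

lemma flux_parent_pow_ge:
  assumes "w \<in> V" "i < depth w"
  shows "flux w \<le> flux ((parent ^^ i) w)"
  using assms(2)
proof (induction i)
  case (Suc i)
  have "flux ((parent ^^ i) w) \<le> flux ((parent ^^ Suc i) w)"
    using Suc.prems parent_pow[OF assms(1), of i] parent_pow[OF assms(1), of "Suc i"]
      parent_pow_ne_rt[OF assms(1), of i] parent_pow_ne_rt[OF assms(1), of "Suc i"]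
    by (intro flux_child_le) (auto simp: children_def)
  then show ?case using Suc by simp
qed simp

lemma u_parent_pow_eq: "u ((parent ^^ i) w) = u w + (\<Sum>j<i. flux ((parent ^^ j) w))"
  by (induction i) (auto simp: flux_def)

lemma u_parent_pow_ge:
  assumes "w \<in> V" "i \<le> depth w"
  shows "u ((parent ^^ i) w) \<ge> u w + real i * flux w"
  using sum_bounded_below[of "{..<i}" "flux w" "\<lambda>j. flux ((parent ^^ j) w)"]
    flux_parent_pow_ge[OF assms(1)] assms(2) by (auto simp: u_parent_pow_eq)

lemma u_ge_depth_mult_flux:
  assumes "w \<in> desc c"
  shows "real (depth w - depth c) * flux w \<le> u c - u w"
  using u_parent_pow_ge[OF descD(1)[OF assms], of "depth w - depth c"] descD(4)[OF assms] by simp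

lemma u_desc_le:
  assumes "w \<in> desc c"
  shows "u w \<le> u c"
proof (cases "w = rt")
  case True
  then show ?thesis using assms rt_desc_iff by auto
next
  case False
  then have "0 \<le> real (depth w - depth c) * flux w"
    using flux_nonneg[OF descD(1)[OF assms]] by simp
  then show ?thesis using u_ge_depth_mult_flux[OF assms] by linarith
qed

lemma flux_ge_absorption:
  assumes "finite T" "c \<in> V" "c \<noteq> rt"
  shows "\<theta> * (\<Sum>w\<in>T \<inter> desc c. deg w * u w) \<le> flux c"
  using assms
proof (induction rule: subtree_induct)
  case (empty c)
  then show ?case using flux_nonneg by simp
next
  case (children c)
  have "\<theta> * (\<Sum>w\<in>T \<inter> desc c. deg w * u w)
      = \<theta> * (if c \<in> T then deg c * u c else 0) + (\<Sum>y\<in>children c. \<theta> * (\<Sum>w\<in>T \<inter> desc y. deg w * u w))"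
    using sum_desc[OF assms(1) children(1), of "\<lambda>w. deg w * u w"]
    by (simp add: distrib_left sum_distrib_left)
  also have "\<dots> \<le> \<theta> * (deg c * u c) + (\<Sum>y\<in>children c. flux y)"
    using children(2) theta_pos by (intro add_mono sum_mono) (auto simp: children_def)
  also have "\<dots> = flux c" using flux_eq children by simp
  finally show ?case .
qed

lemma flux_ge_sum_disjoint:
  assumes I: "finite I" "disjoint_family_on B I" and B: "\<And>i. i \<in> I \<Longrightarrow> finite (B i) \<and> B i \<subseteq> desc c"
    and vol: "\<And>i. i \<in> I \<Longrightarrow> v \<le> (\<Sum>w\<in>B i. deg w)"
    and b: "\<And>i w. i \<in> I \<Longrightarrow> w \<in> B i \<Longrightarrow> b i \<le> u w" "\<And>i. i \<in> I \<Longrightarrow> b i \<ge> 0"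
    and c: "c \<in> V" "c \<noteq> rt"
  shows "\<theta> * v * (\<Sum>i\<in>I. b i) \<le> flux c"
proof -
  have "(\<Sum>i\<in>I. v * b i) \<le> (\<Sum>i\<in>I. \<Sum>w\<in>B i. deg w * u w)"
  proof (rule sum_mono)
    fix i assume i: "i \<in> I"
    have "v * b i \<le> (\<Sum>w\<in>B i. deg w) * b i" using vol[OF i] b(2)[OF i] by (rule mult_right_mono)
    also have "\<dots> \<le> (\<Sum>w\<in>B i. deg w * u w)"
      unfolding sum_distrib_right using b(1)[OF i] by (intro sum_mono mult_left_mono) auto
    finally show "v * b i \<le> (\<Sum>w\<in>B i. deg w * u w)" .
  qed
  also have "\<dots> = (\<Sum>w\<in>(\<Union>i\<in>I. B i). deg w * u w)"
    using I B by (intro sum.UNION_disjoint[symmetric]) (auto simp: disjoint_family_on_def)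
  also have "(\<Union>i\<in>I. B i) = (\<Union>i\<in>I. B i) \<inter> desc c" using B by blast
  finally have "\<theta> * (\<Sum>i\<in>I. v * b i) \<le> \<theta> * (\<Sum>w\<in>(\<Union>i\<in>I. B i) \<inter> desc c. deg w * u w)"
    using theta_pos by simp
  also have "\<dots> \<le> flux c" using I B c by (intro flux_ge_absorption) auto
  finally show ?thesis by (simp add: sum_distrib_left mult.assoc)
qed

lemma flux_le_absorption_plus_outflow:
  assumes "finite T" "finite A" "A \<subseteq> V"
    and bdry: "\<And>w y. w \<in> T \<Longrightarrow> E w y \<Longrightarrow> y \<in> T \<union> A"
    and "c \<in> V" "c \<noteq> rt" "c \<in> T \<union> A"
  shows "flux c \<le> \<theta> * (\<Sum>w\<in>T \<inter> desc c. deg w * u w) + (\<Sum>a\<in>A \<inter> desc c. flux a)"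
proof -
  have absorbed: "0 \<le> \<theta> * (\<Sum>w\<in>T \<inter> desc c. deg w * u w)" for c
    using theta_pos by (intro mult_nonneg_nonneg sum_nonneg) auto
  have outflow: "flux c \<le> (\<Sum>a\<in>A \<inter> desc c. flux a)" if "c \<in> A" "c \<noteq> rt" for c
    using that assms(2,3) desc_self rt_desc_iff by (intro member_le_sum flux_nonneg) auto
  show ?thesis using assms(1,5-7)
  proof (induction rule: subtree_induct)
    case (empty c)
    then have "c \<in> A" using desc_self by blast
    then show ?case using outflow[of c] absorbed[of c] empty by linarith
  next
    case (children c)
    show ?case
    proof (cases "c \<in> A")
      case True
      then show ?thesis using outflow[of c] absorbed[of c] children by linarith
    next
      case False
      then have c: "c \<in> T" using children by blast
      have "flux c = \<theta> * (deg c * u c) + (\<Sum>y\<in>children c. flux y)" using flux_eq children by simp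
      also have "\<dots> \<le> \<theta> * (deg c * u c) + (\<Sum>y\<in>children c.
          \<theta> * (\<Sum>w\<in>T \<inter> desc y. deg w * u w) + (\<Sum>a\<in>A \<inter> desc y. flux a))"
        using children(2) bdry[OF c children_nbr]
        by (intro add_left_mono sum_mono) (auto simp: children_def)
      also have "\<dots> = \<theta> * (\<Sum>w\<in>T \<inter> desc c. deg w * u w) + (\<Sum>a\<in>A \<inter> desc c. flux a)"
        using sum_desc[OF assms(1) children(1), of "\<lambda>w. deg w * u w"]
          sum_desc[OF assms(2) children(1), of flux] c False
        by (simp add: distrib_left sum_distrib_left sum.distrib)
      finally show ?thesis .
    qed
  qed
qed

text \<open>The outflow through \<open>A\<close> is small because \<open>A\<close> has few points, all of them far below \<open>c\<close>.\<close>
lemma flux_le_of_cutset: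
  assumes T: "finite T" and A: "finite A" "A \<subseteq> V"
    and bdry: "\<And>w y. w \<in> T \<Longrightarrow> E w y \<Longrightarrow> y \<in> T \<union> A"
    and L: "L > 0" "\<And>a. a \<in> A \<inter> desc c \<Longrightarrow> L \<le> real (depth a - depth c)"
    and v: "v \<in> desc c" "v \<in> T" "v \<noteq> rt"
  shows "flux v \<le> u c * (\<theta> * (\<Sum>w\<in>T. deg w) + real (card A) / L)"
proof -
  have "flux a \<le> u c / L" if a: "a \<in> A \<inter> desc v" for a
  proof -
    have c: "a \<in> desc c" using a desc_trans[OF _ v(1)] by blast
    have "a \<noteq> rt" using a v(3) rt_desc_iff by auto
    then have "L * flux a \<le> real (depth a - depth c) * flux a"
      using L(2)[of a] a c flux_nonneg[OF descD(1)[OF c]] by (intro mult_right_mono) auto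
    also have "\<dots> \<le> u c" using u_ge_depth_mult_flux[OF c] u_nonneg[of a] by linarith
    finally show ?thesis using L(1) by (simp add: field_simps)
  qed
  then have "(\<Sum>a\<in>A \<inter> desc v. flux a) \<le> real (card (A \<inter> desc v)) * (u c / L)"
    by (rule sum_bounded_above)
  also have "\<dots> \<le> real (card A) * (u c / L)"
    using A L by (intro mult_right_mono) (auto intro: card_mono)
  finally have outflow: "(\<Sum>a\<in>A \<inter> desc v. flux a) \<le> real (card A) * (u c / L)" .
  have "(\<Sum>w\<in>T \<inter> desc v. deg w * u w) \<le> (\<Sum>w\<in>T \<inter> desc v. deg w * u c)"
    using u_desc_le desc_trans[OF _ v(1)] by (intro sum_mono mult_left_mono) auto
  also have "\<dots> \<le> (\<Sum>w\<in>T. deg w * u c)" using T by (intro sum_mono2) auto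
  finally have absorbed: "\<theta> * (\<Sum>w\<in>T \<inter> desc v. deg w * u w) \<le> \<theta> * ((\<Sum>w\<in>T. deg w) * u c)"
    using theta_pos by (simp add: sum_distrib_right)
  have "flux v \<le> \<theta> * (\<Sum>w\<in>T \<inter> desc v. deg w * u w) + (\<Sum>a\<in>A \<inter> desc v. flux a)"
    using T A bdry descD(1)[OF v(1)] v(2,3) by (intro flux_le_absorption_plus_outflow) auto
  also have "\<dots> \<le> \<theta> * ((\<Sum>w\<in>T. deg w) * u c) + real (card A) * (u c / L)"
    using absorbed outflow by (rule add_mono)
  finally show ?thesis by (simp add: algebra_simps)
qed

lemma u_ge_of_cutset:
  assumes T: "finite T" and A: "finite A" "A \<subseteq> V"
    and bdry: "\<And>w y. w \<in> T \<Longrightarrow> E w y \<Longrightarrow> y \<in> T \<union> A"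
    and L: "L > 0" "\<And>a. a \<in> A \<inter> desc c \<Longrightarrow> L \<le> real (depth a - depth c)"
    and w: "w \<in> desc c" and path: "\<And>j. j < depth w - depth c \<Longrightarrow> (parent ^^ j) w \<in> T"
  shows "u c * (1 - real (depth w - depth c) * (\<theta> * (\<Sum>v\<in>T. deg v) + real (card A) / L)) \<le> u w"
proof -
  define n where "n = depth w - depth c"
  note d = descD[OF w]
  have flux_path: "flux ((parent ^^ j) w) \<le> u c * (\<theta> * (\<Sum>v\<in>T. deg v) + real (card A) / L)"
    if j: "j < n" for j
  proof (rule flux_le_of_cutset[OF T A bdry L])
    have "(parent ^^ (n - j)) ((parent ^^ j) w) = c"
      using d(4) j funpow_add[of "n - j" j parent] by (simp add: n_def)
    then show "(parent ^^ j) w \<in> desc c"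
      using parent_pow_desc[of "(parent ^^ j) w" "n - j"] parent_pow[OF d(1), of j] j
      by (simp add: n_def)
    show "(parent ^^ j) w \<noteq> rt" using parent_pow_ne_rt[OF d(1)] j by (simp add: n_def)
  qed (use path j in \<open>auto simp: n_def\<close>)
  have "u c = u w + (\<Sum>j<n. flux ((parent ^^ j) w))"
    using u_parent_pow_eq[of n w] d(4) by (simp add: n_def)
  also have "\<dots> \<le> u w + real n * (u c * (\<theta> * (\<Sum>v\<in>T. deg v) + real (card A) / L))"
    using sum_bounded_above[of "{..<n}" "\<lambda>j. flux ((parent ^^ j) w)"] flux_path by auto
  finally show ?thesis by (simp add: n_def algebra_simps)
qed

end

section \<open>Connected subgraphs of the regular tree\<close>

lemma (in locally_finite_graph) finite_walk_ends: "finite {y. (E ^^ k) x y}"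
proof (induction k)
  case (Suc k)
  have "{y. (E ^^ Suc k) x y} = (\<Union>v\<in>{y. (E ^^ k) x y}. {y. E v y})" by auto
  then show ?case using Suc finite_nbrs by simp
qed simp

locale tree_subgraph =
  fixes n0 :: nat and G :: "nat list set"
  assumes connected: "connectedG n0 G"
begin

abbreviation adj :: "nat list \<Rightarrow> nat list \<Rightarrow> bool" where "adj \<equiv> adjG n0 G"
abbreviation gd :: "nat list \<Rightarrow> nat list \<Rightarrow> nat" where "gd \<equiv> gdist n0 G"

lemma adj_cases: "adj x y \<Longrightarrow> (\<exists>i. x = i # y) \<or> (\<exists>i. y = i # x)"
  by (auto simp: adjG_def adjB_def)

lemma adj_in: "adj x y \<Longrightarrow> x \<in> G \<and> y \<in> G"
  by (simp add: adjG_def)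

lemma adj_sym: "adj x y \<Longrightarrow> adj y x"
  by (auto simp: adjG_def adjB_def)

sublocale locally_finite_graph adj
proof
  show "finite {y. adj x y}" for x
    by (rule finite_subset[of _ "insert (tl x) ((\<lambda>i. i # x) ` {..<n0})"])
      (auto simp: adjG_def adjB_def)
qed (rule adj_sym)

lemma mu_eq_deg: "mu n0 G x = deg x"
  by (simp add: mu_def deg_def)

lemma pstep_eq_funpow_avg: "pstep n0 G k x y = (avg ^^ k) (point_mass y) x"
  by (induction k arbitrary: x) (auto simp: avg_def mu_eq_deg sum_divide_distrib)

lemma qt_eq_heat_kernel: "qt n0 G t x y = heat_kernel t x y"
  by (simp add: qt_def PY_def heat_kernel_def heat_def poisson_mean_def pstep_eq_funpow_avg
      mu_eq_deg)

lemma gpath_iff_successively: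
  "gpath n0 G p x y \<longleftrightarrow> p \<noteq> [] \<and> hd p = x \<and> last p = y \<and> set p \<subseteq> G \<and> successively adj p"
  by (simp add: gpath_def successively_conv_nth)

lemma gpath_rev: "gpath n0 G p x y \<Longrightarrow> gpath n0 G (rev p) y x"
  by (auto simp: gpath_iff_successively hd_rev last_rev intro: successively_mono adj_sym)

lemma gpath_snoc: "gpath n0 G p x y \<Longrightarrow> adj y z \<Longrightarrow> gpath n0 G (p @ [z]) x z"
  using adj_in by (auto simp: gpath_iff_successively successively_append_iff)

lemma exists_gpath_iff_walk:
  assumes "x \<in> G"
  shows "(\<exists>p. gpath n0 G p x y \<and> length p = Suc n) \<longleftrightarrow> (adj ^^ n) x y"
proof
  assume "\<exists>p. gpath n0 G p x y \<and> length p = Suc n"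
  then obtain p where p: "gpath n0 G p x y" "length p = Suc n" by auto
  then have "p ! 0 = x" "p ! n = y" by (auto simp: gpath_def hd_conv_nth last_conv_nth)
  then show "(adj ^^ n) x y"
    unfolding relpowp_fun_conv using p by (intro exI[of _ "\<lambda>i. p ! i"]) (auto simp: gpath_def)
next
  assume "(adj ^^ n) x y"
  then show "\<exists>p. gpath n0 G p x y \<and> length p = Suc n"
  proof (induction n arbitrary: y)
    case 0
    then show ?case using assms by (intro exI[of _ "[x]"]) (simp add: gpath_def)
  next
    case (Suc n)
    then obtain v where "(adj ^^ n) x v" "adj v y" by auto
    with Suc.IH obtain p where "gpath n0 G p x v" "length p = Suc n" by blast
    then show ?case using gpath_snoc[OF _ \<open>adj v y\<close>] by (intro exI[of _ "p @ [y]"]) simp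
  qed
qed

lemma gd_eq_Least_walk: "x \<in> G \<Longrightarrow> gd x y = (LEAST n. (adj ^^ n) x y)"
  unfolding gdist_def using exists_gpath_iff_walk by simp

lemma walk_gd:
  assumes "x \<in> G" "y \<in> G"
  shows "(adj ^^ gd x y) x y"
proof -
  obtain p where p: "gpath n0 G p x y" using connected assms by (auto simp: connectedG_def)
  then have "length p = Suc (length p - 1)" by (auto simp: gpath_def)
  then have "(adj ^^ (length p - 1)) x y" using exists_gpath_iff_walk[OF assms(1)] p by metis
  then show ?thesis unfolding gd_eq_Least_walk[OF assms(1)] by (rule LeastI)
qed

lemma gd_le: "x \<in> G \<Longrightarrow> (adj ^^ n) x y \<Longrightarrow> gd x y \<le> n"
  unfolding gd_eq_Least_walk by (rule Least_le)

lemma walk_sym: "(adj ^^ n) x y \<Longrightarrow> (adj ^^ n) y x"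
proof (induction n arbitrary: y)
  case (Suc n)
  then obtain v where "(adj ^^ n) x v" "adj v y" by auto
  then have "adj y v" "(adj ^^ n) v x" using Suc adj_sym by auto
  then show ?case by (rule relpowp_Suc_I2)
qed simp

lemma gd_sym: "x \<in> G \<Longrightarrow> y \<in> G \<Longrightarrow> gd x y = gd y x"
  using gd_le[OF _ walk_sym[OF walk_gd]] by (metis order_antisym)

lemma gd_triangle:
  assumes "x \<in> G" "y \<in> G" "z \<in> G"
  shows "gd x z \<le> gd x y + gd y z"
  using walk_gd[OF assms(1,2)] walk_gd[OF assms(2,3)]
  by (intro gd_le[OF assms(1)]) (auto simp: relpowp_add)

lemma gd_self: "x \<in> G \<Longrightarrow> gd x x = 0"
  using gd_le[of x 0 x] by simp

lemma gd_eq_0_iff: "x \<in> G \<Longrightarrow> y \<in> G \<Longrightarrow> gd x y = 0 \<longleftrightarrow> x = y"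
  using walk_gd[of x y] gd_self by auto

lemma gd_adj_le:
  assumes "z \<in> G" "adj x y"
  shows "gd z y \<le> Suc (gd z x)"
  using relpowp_Suc_I[OF walk_gd assms(2)] assms adj_in by (intro gd_le) auto

lemma walk_parity: "(adj ^^ n) x y \<Longrightarrow> even (length x + length y + n)"
proof (induction n arbitrary: y)
  case (Suc n)
  then obtain v where v: "(adj ^^ n) x v" "adj v y" by auto
  then have "length v = Suc (length y) \<or> length y = Suc (length v)" using adj_cases[of v y] by auto
  then show ?case using Suc.IH[OF v(1)] by auto
qed simp

lemma gd_adj_ne:
  assumes "z \<in> G" "adj x y"
  shows "gd z x \<noteq> gd z y"
proof
  assume "gd z x = gd z y"
  moreover have "even (length z + length x + gd z x)" "even (length z + length y + gd z y)"
    using walk_parity walk_gd assms adj_in by auto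
  moreover have "length x = Suc (length y) \<or> length y = Suc (length x)"
    using adj_cases[OF assms(2)] by auto
  ultimately show False by auto
qed

lemma exists_closer_nbr:
  assumes "z \<in> G" "w \<in> G" "w \<noteq> z"
  shows "\<exists>y. adj w y \<and> gd z y < gd z w"
proof -
  obtain n where n: "gd z w = Suc n" using gd_eq_0_iff assms not0_implies_Suc by metis
  then have "(adj ^^ Suc n) z w" using walk_gd[OF assms(1,2)] by simp
  then obtain y where "(adj ^^ n) z y" "adj y w" by auto
  then have "adj w y" "gd z y \<le> n" using gd_le[OF assms(1)] adj_sym by auto
  with n show ?thesis by auto
qed

lemma avoiding_walk_to:
  assumes "z \<in> G" "y \<in> G" "gd z y < gd z w"
  shows "(\<lambda>a b. adj a b \<and> b \<noteq> w)\<^sup>*\<^sup>* y z"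
  using assms(2,3)
proof (induction "gd z y" arbitrary: y rule: less_induct)
  case less
  show ?case
  proof (cases "y = z")
    case False
    then obtain y' where y': "adj y y'" "gd z y' < gd z y"
      using exists_closer_nbr[OF assms(1) less.prems(1)] by blast
    then have "(\<lambda>a b. adj a b \<and> b \<noteq> w)\<^sup>*\<^sup>* y' z" using less adj_in by auto
    moreover have "y' \<noteq> w" using y' less.prems by auto
    ultimately show ?thesis using y'(1) by (auto intro: converse_rtranclp_into_rtranclp)
  qed simp
qed

lemma suffix_Cons_avoiding_walk:
  assumes "(\<lambda>a b. adj a b \<and> b \<noteq> w)\<^sup>*\<^sup>* y z" "suffix (i # w) y"
  shows "suffix (i # w) z"
  using assms
proof (induction rule: rtranclp_induct)
  case (step a b)
  then show ?case using adj_cases[of a b] by (auto simp: suffix_Cons)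
qed

lemma not_suffix_avoiding_walk:
  assumes "(\<lambda>a b. adj a b \<and> b \<noteq> w)\<^sup>*\<^sup>* y z" "\<not> suffix w y"
  shows "\<not> suffix w z"
  using assms
proof (induction rule: rtranclp_induct)
  case (step a b)
  then show ?case using adj_cases[of a b] by (auto simp: suffix_Cons)
qed

lemma closer_nbr_unique:
  assumes z: "z \<in> G" and y: "adj w y" "gd z y < gd z w" and y': "adj w y'" "gd z y' < gd z w"
  shows "y = y'"
proof -
  have child: "suffix v z" if "adj w v" "gd z v < gd z w" "v = i # w" for i v
    using suffix_Cons_avoiding_walk[OF avoiding_walk_to[OF z _ that(2)]] that adj_in by auto
  have parent: "\<not> suffix w z" if "adj w v" "gd z v < gd z w" "w = i # v" for i v
    using not_suffix_avoiding_walk[OF avoiding_walk_to[OF z _ that(2)]] that adj_in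
      suffix_length_le[of w v] by auto
  show ?thesis using adj_cases[OF y(1)] adj_cases[OF y'(1)]
  proof (elim disjE exE)
    fix i j assume "w = i # y" "y' = j # w"
    then show ?thesis using parent[OF y] child[OF y'] by (auto dest: suffix_ConsD)
  next
    fix i j assume "y = i # w" "w = j # y'"
    then show ?thesis using parent[OF y'] child[OF y] by (auto dest: suffix_ConsD)
  next
    fix i j assume "y = i # w" "y' = j # w"
    then have "suffix y z" "suffix y' z" "length y = length y'" using child y y' by auto
    then show ?thesis by (metis order_refl suffix_length_suffix suffix_order.antisym)
  qed simp
qed

lemma finite_gball:
  assumes "z \<in> G"
  shows "finite (gball n0 G z r)"
proof (rule finite_subset)
  show "gball n0 G z r \<subseteq> (\<Union>k\<le>nat \<lfloor>r\<rfloor>. {y. (adj ^^ k) z y})"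
  proof
    fix y assume "y \<in> gball n0 G z r"
    then have "y \<in> G" "gd z y \<le> nat \<lfloor>r\<rfloor>" by (auto simp: gball_def le_nat_floor)
    then show "y \<in> (\<Union>k\<le>nat \<lfloor>r\<rfloor>. {y. (adj ^^ k) z y})" using walk_gd[OF assms] by auto
  qed
qed (simp add: finite_walk_ends)

lemma Vol_eq_sum_deg: "Vol n0 G z r = (\<Sum>w\<in>gball n0 G z r. deg w)"
  by (simp add: Vol_def muset_def mu_eq_deg)

lemma heat_kernel_diagonal_le_of_Vol_ge:
  assumes z: "z \<in> G" and "\<rho> > 0" "s > 0" and v: "0 < v" "v \<le> Vol n0 G z \<rho>"
  shows "heat_kernel s z z \<le> max (2 / v) (4 * \<rho> / s)"
proof -
  have "heat_kernel s z z \<le> max (2 / Vol n0 G z \<rho>) (4 * \<rho> / s)"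
    unfolding Vol_eq_sum_deg
  proof (rule heat_kernel_diagonal_le[OF finite_gball[OF z]])
    show "\<exists>n. real n \<le> \<rho> \<and> (adj ^^ n) z w" if "w \<in> gball n0 G z \<rho>" for w
      using that walk_gd[OF z] by (auto simp: gball_def)
  qed (use assms in \<open>auto simp: Vol_eq_sum_deg\<close>)
  also have "\<dots> \<le> max (2 / v) (4 * \<rho> / s)"
    using v by (intro max.mono order_refl divide_left_mono) auto
  finally show ?thesis .
qed

lemma good_heat_kernel_diagonal_le:
  assumes good: "good n0 G lam w r" and r: "r > 0" and s: "s > 0"
  shows "heat_kernel s w w \<le> max (2 * lam ^ 6 / r\<^sup>2) (4 * r / (lam\<^sup>2 * s))"
proof -
  have "w \<in> G" "r\<^sup>2 / lam ^ 6 \<le> Vol n0 G w (r / lam\<^sup>2)" "lam > 0"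
    using good by (auto simp: good_def)
  then show ?thesis
    using heat_kernel_diagonal_le_of_Vol_ge[of w "r / lam\<^sup>2" s "r\<^sup>2 / lam ^ 6"] r s by simp
qed

lemma geod_commute_subset:
  assumes "x \<in> G" "y \<in> G"
  shows "geod n0 G x y \<subseteq> geod n0 G y x"
proof
  fix w assume "w \<in> geod n0 G x y"
  then obtain p where "gpath n0 G p x y" "length p = Suc (gd x y)" "w \<in> set p"
    by (auto simp: geod_def)
  then show "w \<in> geod n0 G y x"
    unfolding geod_def using gpath_rev gd_sym[OF assms] by (intro CollectI exI[of _ "rev p"]) auto
qed

lemma geodD:
  assumes "x \<in> G" "y \<in> G" "w \<in> geod n0 G x y"
  shows "w \<in> G" "gd x w + gd w y = gd x y"
proof -
  obtain p where p: "gpath n0 G p x y" "length p = Suc (gd x y)" "w \<in> set p"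
    using assms by (auto simp: geod_def)
  then show w: "w \<in> G" by (auto simp: gpath_def)
  obtain i where i: "i \<le> gd x y" "p ! i = w"
    using p(2,3) by (auto simp: in_set_conv_nth less_Suc_eq_le)
  have ends: "p ! 0 = x" "p ! gd x y = y"
    using p(1,2) hd_conv_nth[of p] last_conv_nth[of p] by (auto simp: gpath_def)
  have segment: "(adj ^^ (k - j)) (p ! j) (p ! k)" if "j \<le> k" "k \<le> gd x y" for j k
    using relpowp_funI[of "k - j" adj "(!) p" j] p(1,2) that by (auto simp: gpath_def)
  have "gd x w \<le> i" "gd w y \<le> gd x y - i"
    using segment[of 0 i] segment[of i "gd x y"] i ends gd_le assms(1) w by auto
  then show "gd x w + gd w y = gd x y" using gd_triangle[OF assms(1) w assms(2)] i(1) by linarith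
qed

definition component_avoiding :: "nat list set \<Rightarrow> nat list \<Rightarrow> nat list set" where
  "component_avoiding A z = {v. \<exists>p. gpath n0 G p z v \<and> set p \<inter> A = {}}"

lemma component_avoiding_subset_gball:
  assumes "cutset n0 G z r A"
  shows "component_avoiding A z \<subseteq> gball n0 G z r"
proof
  fix v assume "v \<in> component_avoiding A z"
  then obtain p where p: "gpath n0 G p z v" "set p \<inter> A = {}" by (auto simp: component_avoiding_def)
  then have "v \<in> G" by (metis gpath_def last_in_set subsetD)
  then show "v \<in> gball n0 G z r" using assms p by (auto simp: cutset_def)
qed

lemma nbr_component_avoiding:
  assumes "v \<in> component_avoiding A z" "adj v y"
  shows "y \<in> component_avoiding A z \<union> A"
proof (rule UnCI)
  assume "y \<notin> A"
  obtain p where p: "gpath n0 G p z v" "set p \<inter> A = {}"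
    using assms(1) by (auto simp: component_avoiding_def)
  then show "y \<in> component_avoiding A z"
    using gpath_snoc[OF p(1) assms(2)] \<open>y \<notin> A\<close>
    by (auto simp: component_avoiding_def intro!: exI[of _ "p @ [y]"])
qed

lemma near_in_component_avoiding:
  assumes cut: "cutset n0 G z r A" and z: "z \<in> G" and v: "v \<in> G" "real (gd z v) < r / 4"
  shows "v \<in> component_avoiding A z"
proof -
  obtain p where p: "gpath n0 G p z v" "length p = Suc (gd z v)"
    using exists_gpath_iff_walk[OF z] walk_gd[OF z v(1)] by blast
  have "a \<notin> A" if "a \<in> set p" for a
  proof
    assume "a \<in> A"
    have "a \<in> geod n0 G z v" using p that by (auto simp: geod_def)
    then have "gd z a \<le> gd z v" using geodD(2)[OF z v(1)] by fastforce
    moreover have "r / 4 \<le> real (gd z a)" using cut \<open>a \<in> A\<close> by (auto simp: cutset_def)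
    ultimately show False using v(2) by linarith
  qed
  then show ?thesis using p(1) by (auto simp: component_avoiding_def)
qed

end

lemma obtain_cutset_of_Mcut:
  assumes "Mcut n0 G z r < ereal b"
  obtains A where "cutset n0 G z r A" "real (card A) < b"
  using assms that by (auto simp: Mcut_def Inf_less_iff)

locale pointed_subgraph = tree_subgraph +
  fixes rt :: "nat list"
  assumes rt_in_G: "rt \<in> G"
begin

definition toward :: "nat list \<Rightarrow> nat list" where
  "toward w = (SOME y. adj w y \<and> gd rt y < gd rt w)"

lemma toward:
  assumes "w \<in> G" "w \<noteq> rt"
  shows adj_toward: "adj w (toward w)" and gd_toward_less: "gd rt (toward w) < gd rt w"
  unfolding toward_def using someI_ex[OF exists_closer_nbr[OF rt_in_G assms]] by auto

lemma toward_eqI: "adj w y \<Longrightarrow> gd rt y < gd rt w \<Longrightarrow> toward w = y"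
  using closer_nbr_unique[OF rt_in_G] toward[of w] adj_in gd_self[OF rt_in_G] by force

sublocale rooted_tree adj G rt toward "gd rt"
proof
  show "gd rt w = Suc (gd rt (toward w))" if "w \<in> G" "w \<noteq> rt" for w
    using gd_adj_le[OF rt_in_G adj_sym[OF adj_toward]] gd_toward_less that by fastforce
  show "w \<noteq> rt \<and> y = toward w \<or> y \<noteq> rt \<and> toward y = w" if "adj w y" for w y
    using gd_adj_ne[OF rt_in_G that] toward_eqI[OF that] toward_eqI[OF adj_sym[OF that]]
      gd_self[OF rt_in_G]
    by (cases "gd rt y < gd rt w") auto
qed (use rt_in_G gd_self adj_toward adj_in in auto)

lemma gd_parent_pow_le: "w \<in> G \<Longrightarrow> i \<le> gd rt w \<Longrightarrow> gd w ((toward ^^ i) w) \<le> i"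
  by (rule gd_le[OF _ walk_parent_pow])

lemma gd_desc_le: "w \<in> desc c \<Longrightarrow> gd w c \<le> gd rt w - gd rt c"
  using gd_parent_pow_le[of w "gd rt w - gd rt c"] descD[of w c] by simp

lemma geod_ancestor:
  assumes "x \<in> G" "w \<in> geod n0 G x rt"
  shows "w = (toward ^^ gd x w) x" "gd x w \<le> gd rt x"
proof -
  note w = geodD[OF assms(1) rt_in_G assms(2)]
  show depth_le: "gd x w \<le> gd rt x" using w(2) gd_sym[OF assms(1) rt_in_G] by simp
  have "gd rt w = gd rt ((toward ^^ gd x w) x)"
    using parent_pow[OF assms(1) depth_le] w gd_sym[OF assms(1) rt_in_G] gd_sym[OF w(1) rt_in_G] by simp
  then show "w = (toward ^^ gd x w) x"
    using walk_desc[OF assms(1) walk_gd[OF assms(1) w(1)] depth_le] desc_self[OF w(1)]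
    by (metis desc_eq)
qed

lemma card_geod_subset_le:
  assumes "x \<in> G" "Z \<subseteq> geod n0 G x rt"
  shows "card Z \<le> Suc (gd rt x)"
proof -
  have "Z \<subseteq> (\<lambda>j. (toward ^^ j) x) ` {..gd rt x}"
    using geod_ancestor[OF assms(1)] assms(2) by blast
  then have "card Z \<le> card {..gd rt x}" by (rule surj_card_le[rotated]) simp
  then show ?thesis by simp
qed

lemma not_desc_across_root:
  assumes geod: "rt \<in> geod n0 G x y" and x: "x \<in> G" "x \<in> desc c" and y: "y \<in> G"
    and c: "c \<in> children rt"
  shows "y \<notin> desc c"
proof
  assume "y \<in> desc c"
  have c': "c \<in> G" "gd rt c = 1"
    using c depth_child[OF c] gd_self[OF rt_in_G] by (auto simp: children_def)
  have "gd x c \<le> gd rt x - 1" "gd y c \<le> gd rt y - 1" "1 \<le> gd rt x"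
    using gd_desc_le[OF x(2)] gd_desc_le[OF \<open>y \<in> desc c\<close>] descD(3)[OF x(2)] c' by auto
  moreover have "gd rt x + gd rt y = gd x y"
    using geodD(2)[OF x(1) y geod] gd_sym[OF x(1) rt_in_G] by simp
  moreover have "gd x y \<le> gd x c + gd y c"
    using gd_triangle[OF x(1) c'(1) y] gd_sym[OF c'(1) y] by simp
  ultimately show False by linarith
qed

end

section \<open>Decay across good balls\<close>

context pointed_subgraph
begin

lemma gball_subset_desc:
  assumes z: "z \<in> G" and k: "nat \<lfloor>\<rho>\<rfloor> \<le> gd rt z"
  shows "gball n0 G z \<rho> \<subseteq> desc ((toward ^^ nat \<lfloor>\<rho>\<rfloor>) z)"
proof
  fix w assume "w \<in> gball n0 G z \<rho>"
  then have w: "w \<in> G" "gd z w \<le> nat \<lfloor>\<rho>\<rfloor>" by (auto simp: gball_def le_nat_floor)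
  then show "w \<in> desc ((toward ^^ nat \<lfloor>\<rho>\<rfloor>) z)"
    by (intro walk_desc_pow[OF z walk_gd[OF z]] k)
qed

lemma depth_diff_apex_le:
  assumes "z \<in> G" "k \<le> gd rt z" "w \<in> G"
  shows "gd rt w - gd rt ((toward ^^ k) z) \<le> gd z w + k"
  using gd_triangle[OF rt_in_G assms(1,3)] parent_pow[OF assms(1,2)] by simp

lemma gd_path_to_apex_le:
  assumes z: "z \<in> G" and k: "k \<le> gd rt z" and w: "w \<in> G" "gd z w \<le> k"
    and j: "j < gd rt w - gd rt ((toward ^^ k) z)"
  shows "(toward ^^ j) w \<in> G" "gd z ((toward ^^ j) w) \<le> 3 * k"
proof -
  have v: "(toward ^^ j) w \<in> G" "gd w ((toward ^^ j) w) \<le> j"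
    using parent_pow[OF w(1), of j] gd_parent_pow_le[OF w(1), of j] j by auto
  show "(toward ^^ j) w \<in> G" by (rule v)
  show "gd z ((toward ^^ j) w) \<le> 3 * k"
    using gd_triangle[OF z w(1) v(1)] depth_diff_apex_le[OF z k w(1)] v(2) w(2) j by linarith
qed

lemma gd_le_depth_below_apex:
  assumes z: "z \<in> G" and k: "k \<le> gd rt z" and a: "a \<in> desc ((toward ^^ k) z)"
  shows "gd z a \<le> k + (gd rt a - gd rt ((toward ^^ k) z))"
  using gd_triangle[OF z descD(2,1)[OF a]] gd_parent_pow_le[OF z k] gd_desc_le[OF a]
    gd_sym[OF descD(1,2)[OF a]] by linarith

lemma enumerate_disjoint_balls_on_geod:
  assumes x: "x \<in> G" and Z: "finite Z" "Z \<subseteq> geod n0 G x rt"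
    and disjoint: "disjoint_family_on (\<lambda>z. gball n0 G z r) Z" and r: "r > 0"
  obtains e :: "nat \<Rightarrow> nat" where
    "\<And>m. m < card Z \<Longrightarrow> e m \<le> gd rt x" "\<And>m. m < card Z \<Longrightarrow> (toward ^^ e m) x \<in> Z"
    "\<And>m m'. m < m' \<Longrightarrow> m' < card Z \<Longrightarrow> real (e m) + r < real (e m')"
proof -
  have ancestor: "z = (toward ^^ gd x z) x" "gd x z \<le> gd rt x" if "z \<in> Z" for z
    using geod_ancestor[OF x] Z(2) that by auto
  have "inj_on (gd x) Z" using ancestor(1) by (metis inj_onI)
  then obtain e :: "nat \<Rightarrow> nat"
    where e: "strict_mono_on {..<card Z} e" "\<And>m. m < card Z \<Longrightarrow> e m \<in> gd x ` Z"
    using finite_enumerate[of "gd x ` Z"] Z(1) by (auto simp: card_image)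
  have point: "(toward ^^ e m) x \<in> Z" "gd x ((toward ^^ e m) x) = e m" "e m \<le> gd rt x"
    if "m < card Z" for m
    using e(2)[OF that] ancestor by auto
  have gap: "real (e m) + r < real (e m')" if m: "m < m'" "m' < card Z" for m m'
  proof (rule ccontr)
    assume close: "\<not> ?thesis"
    define z z' where "z = (toward ^^ e m) x" and "z' = (toward ^^ e m') x"
    have lt: "e m < e m'" using strict_mono_onD[OF e(1)] m by auto
    have in_Z: "z \<in> Z" "z' \<in> Z" and ne: "z \<noteq> z'"
      using point[of m] point[of m'] m lt by (auto simp: z_def z'_def)
    have in_G: "z \<in> G" "z' \<in> G" "gd rt z = gd rt x - e m"
      using parent_pow[OF x] point(3) m by (auto simp: z_def z'_def)
    have "z' = (toward ^^ (e m' - e m)) z"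
      using lt funpow_add[of "e m' - e m" "e m" toward] by (simp add: z_def z'_def)
    then have "gd z z' \<le> e m' - e m"
      using gd_parent_pow_le[OF in_G(1), of "e m' - e m"] in_G(3) point(3)[OF m(2)] lt by simp
    then have "z' \<in> gball n0 G z r \<inter> gball n0 G z' r"
      using in_G close lt r gd_self by (auto simp: gball_def)
    then show False using disjoint in_Z ne by (auto simp: disjoint_family_on_def)
  qed
  show ?thesis using that[of e] point gap by blast
qed

end

locale killed_subgraph = pointed_subgraph +
  fixes \<theta> :: real
  assumes theta_gt_0: "\<theta> > 0"
begin

sublocale killed_tree adj G rt toward "gd rt" \<theta>
  by unfold_locales (rule theta_gt_0)

lemma u_apex_le_of_cutset:
  assumes z: "z \<in> G" and cut: "cutset n0 G z r A" and r: "r > 0" and \<rho>: "\<rho> \<ge> 0" "64 * \<rho> \<le> r"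
    and k: "k = nat \<lfloor>\<rho>\<rfloor>" "k \<le> gd rt z" and w: "w \<in> gball n0 G z \<rho>"
    and loss: "2 * \<rho> * (\<theta> * Vol n0 G z r + real (card A) / (r / 5)) \<le> 1 / 2"
  shows "u ((toward ^^ k) z) \<le> 2 * u w"
proof -
  define c where "c = (toward ^^ k) z"
  define T where "T = component_avoiding A z"
  have k_le: "real k \<le> \<rho>" using k(1) \<rho>(1) by linarith
  have w': "w \<in> G" "gd z w \<le> k" using w k(1) by (auto simp: gball_def le_nat_floor)
  have A: "finite A" "A \<subseteq> G" "\<And>a. a \<in> A \<Longrightarrow> r / 4 \<le> real (gd z a)"
    using cut by (auto simp: cutset_def)
  have T: "finite T" "T \<subseteq> gball n0 G z r"
    unfolding T_def using component_avoiding_subset_gball[OF cut] finite_gball[OF z]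
    by (auto intro: finite_subset)
  have "real (gd rt w - gd rt c) * (\<theta> * (\<Sum>v\<in>T. deg v) + real (card A) / (r / 5))
      \<le> (2 * \<rho>) * (\<theta> * Vol n0 G z r + real (card A) / (r / 5))"
    unfolding Vol_eq_sum_deg
    using depth_diff_apex_le[OF z k(2) w'(1)] w'(2) k_le T finite_gball[OF z] \<rho>(1) theta_pos r
    by (intro mult_mono add_right_mono mult_left_mono sum_mono2 add_nonneg_nonneg
        mult_nonneg_nonneg[of \<theta>] sum_nonneg) (auto simp: c_def)
  also have "\<dots> \<le> 1 / 2" by (rule loss)
  finally have "u c * (1 / 2)
      \<le> u c * (1 - real (gd rt w - gd rt c) * (\<theta> * (\<Sum>v\<in>T. deg v) + real (card A) / (r / 5)))"
    by (intro mult_left_mono) auto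
  also have "\<dots> \<le> u w"
  proof (rule u_ge_of_cutset[OF T(1) A(1,2)])
    show "y \<in> T \<union> A" if "v \<in> T" "adj v y" for v y
      using that nbr_component_avoiding unfolding T_def by blast
    show "w \<in> desc c" using gball_subset_desc[OF z] w k by (auto simp: c_def)
    show "(toward ^^ j) w \<in> T" if "j < gd rt w - gd rt c" for j
      unfolding T_def using gd_path_to_apex_le[OF z k(2) w'] that k_le \<rho>(2) r
      by (intro near_in_component_avoiding[OF cut z]) (fastforce simp: c_def)+
    show "r / 5 \<le> real (gd rt a - gd rt c)" if "a \<in> A \<inter> desc c" for a
      using gd_le_depth_below_apex[OF z k(2), of a] A(3)[of a] that k_le \<rho>(2)
      by (fastforce simp: c_def)
  qed (use r in simp)
  finally show ?thesis by (simp add: c_def)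
qed

lemma u_apex_le_of_good_ball:
  assumes good: "good n0 G lam z r" and r: "r > 0" and small: "\<theta> * r ^ 3 \<le> 3 / 32"
    and k: "k = nat \<lfloor>r / lam\<rfloor>" "k \<le> gd rt z" and w: "w \<in> gball n0 G z (r / lam)"
  shows "u ((toward ^^ k) z) \<le> 2 * u w"
proof -
  have lam: "lam \<ge> 64" and z: "z \<in> G" and vol: "Vol n0 G z r \<le> r\<^sup>2 * lam"
    and "Mcut n0 G z r \<le> ereal (lam / 64)"
    using good by (auto simp: good_def)
  then have "Mcut n0 G z r < ereal (lam / 32)" by (auto elim!: le_less_trans)
  then obtain A where A: "cutset n0 G z r A" "real (card A) < lam / 32"
    by (rule obtain_cutset_of_Mcut)
  have "2 * (r / lam) * (\<theta> * Vol n0 G z r + real (card A) / (r / 5))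
      \<le> 2 * (r / lam) * (\<theta> * (r\<^sup>2 * lam) + (lam / 32) / (r / 5))"
    using vol A(2) r lam theta_pos by (intro mult_left_mono add_mono divide_right_mono) auto
  also have "\<dots> = 2 * (\<theta> * r ^ 3) + 5 / 16"
    using r lam by (simp add: field_simps power2_eq_square power3_eq_cube)
  also have "\<dots> \<le> 1 / 2" using small by simp
  finally have loss: "2 * (r / lam) * (\<theta> * Vol n0 G z r + real (card A) / (r / 5)) \<le> 1 / 2" .
  have "64 * (r / lam) \<le> r" "r / lam \<ge> 0" using r lam by (auto simp: field_simps)
  then show ?thesis using u_apex_le_of_cutset[OF z A(1) r _ _ k w loss] by simp
qed

end

lemma cumulative_growth:
  fixes U :: "nat \<Rightarrow> real"
  assumes \<sigma>: "0 \<le> \<sigma>" "\<sigma> \<le> 1" and U_nonneg: "\<And>m. U m \<ge> 0"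
    and step: "\<And>m. m \<le> M \<Longrightarrow> U (Suc m) \<ge> U m + \<sigma>\<^sup>2 * (\<Sum>l\<le>m. U l)"
  shows "U (Suc M) \<ge> \<sigma> * (1 + \<sigma>) ^ M * U 0"
proof -
  define \<Phi> where "\<Phi> m = U m + \<sigma> * (\<Sum>l\<le>m. U l)" for m
  have "(1 + \<sigma>) ^ m * U 0 \<le> \<Phi> m" if "m \<le> M" for m
    using that
  proof (induction m)
    case 0
    then show ?case using \<sigma> U_nonneg[of 0] by (simp add: \<Phi>_def)
  next
    case (Suc m)
    have step_m: "U m + \<sigma>\<^sup>2 * (\<Sum>l\<le>m. U l) \<le> U (Suc m)" using step Suc.prems by simp
    moreover have "0 \<le> \<sigma>\<^sup>2 * (\<Sum>l\<le>m. U l)"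
      using U_nonneg by (intro mult_nonneg_nonneg sum_nonneg) auto
    ultimately have "\<sigma> * U m \<le> \<sigma> * U (Suc m)" using \<sigma> by (intro mult_left_mono) auto
    then have "(1 + \<sigma>) * \<Phi> m \<le> \<Phi> (Suc m)"
      using step_m by (simp add: \<Phi>_def algebra_simps power2_eq_square)
    moreover have "(1 + \<sigma>) * ((1 + \<sigma>) ^ m * U 0) \<le> (1 + \<sigma>) * \<Phi> m"
      using Suc \<sigma> by (intro mult_left_mono) auto
    ultimately show ?case by simp
  qed
  then have "\<sigma> * ((1 + \<sigma>) ^ M * U 0) \<le> \<sigma> * \<Phi> M" using \<sigma> by (intro mult_left_mono) auto
  also have "\<sigma> * \<Phi> M = \<sigma> * U M + \<sigma>\<^sup>2 * (\<Sum>l\<le>M. U l)"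
    by (simp add: \<Phi>_def algebra_simps power2_eq_square)
  also have "\<dots> \<le> U M + \<sigma>\<^sup>2 * (\<Sum>l\<le>M. U l)"
    using \<sigma> U_nonneg[of M] mult_right_mono[of \<sigma> 1 "U M"] by simp
  also have "\<dots> \<le> U (Suc M)" using step by simp
  finally show ?thesis by (simp add: mult.assoc)
qed

text \<open>\<open>e m\<close> is the distance from \<open>x\<close> to the \<open>m\<close>-th centre along the geodesic towards \<open>rt\<close>. Moving
  the centre up by \<open>height\<close> steps gives an apex below which its whole core lies.\<close>
locale good_ball_chain = killed_subgraph +
  fixes x :: "nat list" and r lam :: real and n :: nat and e :: "nat \<Rightarrow> nat"
  assumes x_in: "x \<in> G" and r_pos: "r > 0" and lam_ge: "lam \<ge> 64"
    and small: "\<theta> * r ^ 3 \<le> 3 / 32"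
    and e_le: "m < n \<Longrightarrow> e m \<le> gd rt x"
    and e_gap: "m < m' \<Longrightarrow> m' < n \<Longrightarrow> real (e m) + r < real (e m')"
    and good_center: "m < n \<Longrightarrow> good n0 G lam ((toward ^^ e m) x) r"
begin

definition center :: "nat \<Rightarrow> nat list" where
  "center m = (toward ^^ e m) x"

definition core :: "nat \<Rightarrow> nat list set" where
  "core m = gball n0 G (center m) (r / lam)"

definition height :: nat where
  "height = nat \<lfloor>r / lam\<rfloor>"

definition apex :: "nat \<Rightarrow> nat list" where
  "apex m = (toward ^^ (e m + height)) x"

lemma core_radius: "0 < r / lam" "r / lam \<le> r / 64" "real height \<le> r / lam"
proof -
  show "0 < r / lam" using r_pos lam_ge by simp
  then show "real height \<le> r / lam" unfolding height_def by linarith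
  show "r / lam \<le> r / 64" using r_pos lam_ge by (intro divide_left_mono) auto
qed

lemma e_less: "m < m' \<Longrightarrow> m' < n \<Longrightarrow> e m + height < e m'"
  using e_gap[of m m'] core_radius r_pos by linarith

lemma center_in: "m < n \<Longrightarrow> center m \<in> G \<and> gd rt (center m) = gd rt x - e m"
  unfolding center_def using parent_pow[OF x_in] e_le by simp

lemma apex_eq_center: "apex m = (toward ^^ height) (center m)"
  using funpow_add[of height "e m" toward] by (simp add: apex_def center_def add.commute)

lemma depth_below_apex: "Suc m < n \<Longrightarrow> e m + height < gd rt x"
  using e_less[of m "Suc m"] e_le[of "Suc m"] by simp

lemma apex_in: "Suc m < n \<Longrightarrow> apex m \<in> G \<and> gd rt (apex m) = gd rt x - (e m + height) \<and> apex m \<noteq> rt"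
  unfolding apex_def
  using parent_pow[OF x_in] parent_pow_ne_rt[OF x_in] depth_below_apex[of m] by simp

lemma toward_pow_apex:
  assumes "m \<le> m'" "m' < n"
  shows "(toward ^^ (e m' - e m)) (apex m) = apex m'"
proof -
  have "e m \<le> e m'" using assms e_less[of m m'] by (cases "m = m'") auto
  then have "e m' + height = (e m' - e m) + (e m + height)" by simp
  then show ?thesis unfolding apex_def by (simp only: funpow_add comp_apply)
qed

lemma apex_desc_apex:
  assumes "l \<le> m" "Suc m < n"
  shows "apex l \<in> desc (apex m)"
  using parent_pow_desc[of "apex l" "e m - e l"] toward_pow_apex[of l m] apex_in[of l]
    depth_below_apex[of m] assms
  by auto

lemma core_subset_desc_apex:
  assumes "Suc m < n"
  shows "core m \<subseteq> desc (apex m)"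
  unfolding core_def apex_eq_center height_def
  using gball_subset_desc[of "center m" "r / lam"] center_in[of m] depth_below_apex[OF assms] assms
  by (simp add: height_def)

lemma u_apex_le_of_core:
  assumes "Suc m < n" "w \<in> core m"
  shows "u (apex m) \<le> 2 * u w"
  unfolding apex_eq_center
proof (rule u_apex_le_of_good_ball[OF _ r_pos small height_def])
  show "good n0 G lam (center m) r" using good_center assms by (simp add: center_def)
  show "height \<le> gd rt (center m)" using center_in[of m] depth_below_apex[of m] assms by simp
qed (use assms in \<open>simp add: core_def\<close>)

lemma core_disjoint:
  assumes "m < m'" "m' < n"
  shows "core m \<inter> core m' = {}"
proof -
  have False if w: "w \<in> core m" "w \<in> core m'" for w
  proof -
    have c: "center m \<in> G" "center m' \<in> G"
        "gd rt (center m) = gd rt x - e m" "gd rt (center m') = gd rt x - e m'"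
      using center_in[of m] center_in[of m'] assms by auto
    have w': "w \<in> G" "real (gd (center m) w) \<le> r / lam" "real (gd (center m') w) \<le> r / lam"
      using w by (auto simp: core_def gball_def)
    have "gd rt (center m) \<le> gd rt (center m') + (gd (center m') w + gd (center m) w)"
      using gd_triangle[OF rt_in_G c(2,1)] gd_triangle[OF c(2) w'(1) c(1)] gd_sym[OF c(1) w'(1)]
      by linarith
    then have "e m' \<le> e m + (gd (center m') w + gd (center m) w)"
      using c e_le[of m'] assms by linarith
    then show False using w' e_gap[OF assms] core_radius r_pos by linarith
  qed
  then show ?thesis by blast
qed

lemma flux_apex_ge:
  assumes m: "Suc m < n"
  shows "\<theta> * (r\<^sup>2 / lam ^ 4) * (\<Sum>l\<le>m. u (apex l) / 2) \<le> flux (apex m)"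
proof (rule flux_ge_sum_disjoint[where B = core])
  show "disjoint_family_on core {..m}"
    unfolding disjoint_family_on_def
  proof (intro ballI impI)
    fix i j assume "i \<in> {..m}" "j \<in> {..m}" "i \<noteq> j"
    then show "core i \<inter> core j = {}"
      using core_disjoint[of i j] core_disjoint[of j i] m by (cases i j rule: linorder_cases) auto
  qed
  fix l assume "l \<in> {..m}"
  then have l: "l \<le> m" "Suc l < n" using m by auto
  show "finite (core l) \<and> core l \<subseteq> desc (apex m)"
    using core_subset_desc_apex[OF l(2)] desc_trans[OF _ apex_desc_apex[OF l(1) m]]
      center_in[of l] l(2)
    by (auto simp: core_def intro: finite_gball)
  show "r\<^sup>2 / lam ^ 4 \<le> (\<Sum>w\<in>core l. deg w)"
    using good_center[of l] l(2) by (simp add: good_def core_def center_def Vol_eq_sum_deg)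
  show "u (apex l) / 2 \<le> u w" if "w \<in> core l" for w
    using u_apex_le_of_core[OF l(2) that] by simp
qed (use apex_in[OF m] in auto)

lemma u_apex_Suc_ge:
  assumes m: "Suc (Suc m) < n"
  shows "u (apex m) + \<theta> * r ^ 3 / (2 * lam ^ 4) * (\<Sum>l\<le>m. u (apex l)) \<le> u (apex (Suc m))"
proof -
  have "\<theta> * r ^ 3 / (2 * lam ^ 4) * (\<Sum>l\<le>m. u (apex l))
      = r * (\<theta> * (r\<^sup>2 / lam ^ 4) * (\<Sum>l\<le>m. u (apex l) / 2))"
    by (simp add: power2_eq_square power3_eq_cube mult_ac flip: sum_divide_distrib)
  also have "\<dots> \<le> r * flux (apex m)" using flux_apex_ge[of m] m r_pos by (intro mult_left_mono) auto
  also have "\<dots> \<le> real (e (Suc m) - e m) * flux (apex m)"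
    using e_gap[of m "Suc m"] e_less[of m "Suc m"] m apex_in[of m]
    by (intro mult_right_mono flux_nonneg) auto
  finally have "u (apex m) + \<theta> * r ^ 3 / (2 * lam ^ 4) * (\<Sum>l\<le>m. u (apex l))
      \<le> u (apex m) + real (e (Suc m) - e m) * flux (apex m)" by simp
  also have "\<dots> \<le> u ((toward ^^ (e (Suc m) - e m)) (apex m))"
    using apex_in[of m] depth_below_apex[of "Suc m"] m by (intro u_parent_pow_ge) auto
  also have "\<dots> = u (apex (Suc m))" using toward_pow_apex[of m "Suc m"] m by simp
  finally show ?thesis .
qed

lemma u_start_le:
  assumes n: "n \<ge> 3" and \<sigma>: "0 \<le> \<sigma>" "\<sigma> \<le> 1" "2 * lam ^ 4 * \<sigma>\<^sup>2 = \<theta> * r ^ 3"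
  shows "\<sigma> * (1 + \<sigma>) ^ (n - 3) * u x \<le> 1"
proof -
  have "x \<in> desc (apex 0)"
    unfolding apex_def using depth_below_apex[of 0] n by (intro parent_pow_desc[OF x_in]) auto
  then have "\<sigma> * (1 + \<sigma>) ^ (n - 3) * u x \<le> \<sigma> * (1 + \<sigma>) ^ (n - 3) * u (apex 0)"
    using \<sigma> by (intro mult_left_mono u_desc_le) auto
  also have "\<dots> \<le> u (apex (Suc (n - 3)))"
  proof (rule cumulative_growth[OF \<sigma>(1,2)])
    fix m assume "m \<le> n - 3"
    moreover have "\<theta> * r ^ 3 / (2 * lam ^ 4) = \<sigma>\<^sup>2" using \<sigma>(3)[symmetric] lam_ge by simp
    ultimately show "u (apex m) + \<sigma>\<^sup>2 * (\<Sum>l\<le>m. u (apex l)) \<le> u (apex (Suc m))"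
      using u_apex_Suc_ge[of m] n by auto
  qed simp
  also have "\<dots> \<le> 1" by (rule hitting_laplace_le_1[OF theta_pos])
  finally show ?thesis .
qed

end

lemma exp_le_one_plus_power:
  fixes \<sigma> k :: real
  assumes \<sigma>: "0 \<le> \<sigma>" "\<sigma> \<le> 1" and n: "k \<le> real n" "3 \<le> n"
  shows "exp (\<sigma> / 2 * k - 2) \<le> (1 + \<sigma>) ^ (n - 3)"
proof -
  have "exp (\<sigma> / 2) \<le> 1 + \<sigma> / 2 + (\<sigma> / 2)\<^sup>2" using \<sigma> by (intro exp_bound) auto
  also have "\<dots> \<le> 1 + \<sigma>"
    using \<sigma> mult_left_le[of \<sigma> \<sigma>] by (simp add: power2_eq_square)
  finally have "exp (\<sigma> / 2) \<le> 1 + \<sigma>" .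
  have "\<sigma> / 2 * k - 2 \<le> real (n - 3) * (\<sigma> / 2)"
    using mult_left_mono[OF n(1), of "\<sigma> / 2"] \<sigma> n(2) by (simp add: of_nat_diff algebra_simps)
  then have "exp (\<sigma> / 2 * k - 2) \<le> exp (\<sigma> / 2) ^ (n - 3)" by (simp flip: exp_of_nat_mult)
  also have "\<dots> \<le> (1 + \<sigma>) ^ (n - 3)" using \<open>exp (\<sigma> / 2) \<le> 1 + \<sigma>\<close> by (intro power_mono) auto
  finally show ?thesis .
qed

lemma (in killed_subgraph) u_le_of_F1:
  assumes F1: "F1 n0 G lam x rt (2 * r) k" and k: "k \<ge> 3" and r: "r > 0"
    and \<sigma>: "0 < \<sigma>" "\<sigma> \<le> 1" "2 * lam ^ 4 * \<sigma>\<^sup>2 = \<theta> * r ^ 3" and small: "\<theta> * r ^ 3 \<le> 3 / 32"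
  shows "u x \<le> exp 2 / \<sigma> * exp (- (\<sigma> / 2 * k))"
proof -
  obtain Z where x: "x \<in> G" and Z: "finite Z" "Z \<subseteq> geod n0 G x rt" "k \<le> real (card Z)"
    and disjoint: "disjoint_family_on (\<lambda>z. gball n0 G z r) Z"
    and good: "\<And>z. z \<in> Z \<Longrightarrow> good n0 G lam z r"
    using F1 by (auto simp: F1_def disjoint_family_on_def)
  have card: "3 \<le> card Z" using Z(3) k by linarith
  obtain e :: "nat \<Rightarrow> nat" where e: "\<And>m. m < card Z \<Longrightarrow> e m \<le> gd rt x"
    "\<And>m. m < card Z \<Longrightarrow> (toward ^^ e m) x \<in> Z"
    "\<And>m m'. m < m' \<Longrightarrow> m' < card Z \<Longrightarrow> real (e m) + r < real (e m')"
    using enumerate_disjoint_balls_on_geod[OF x Z(1,2) disjoint r] by blast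
  have "lam \<ge> 64" using good[OF e(2)[of 0]] card by (auto simp: good_def)
  then interpret good_ball_chain n0 G rt \<theta> x r lam "card Z" e
    by unfold_locales (use x r small e good in auto)
  have "\<sigma> * exp (\<sigma> / 2 * k - 2) * u x \<le> \<sigma> * (1 + \<sigma>) ^ (card Z - 3) * u x"
    using \<sigma> Z(3) card by (intro mult_right_mono mult_left_mono exp_le_one_plus_power) auto
  also have "\<dots> \<le> 1" using u_start_le[OF card _ \<sigma>(2,3)] \<sigma>(1) by simp
  finally have "\<sigma> * (exp (\<sigma> / 2 * k) / exp 2) * u x \<le> 1" by (simp only: exp_diff)
  then show ?thesis using \<sigma>(1) by (simp add: exp_minus field_simps)
qed

context tree_subgraph
begin

lemma F1_commute: "F1 n0 G lam x y r k \<Longrightarrow> F1 n0 G lam y x r k"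
  unfolding F1_def using geod_commute_subset[of x y] by (meson order_trans)

lemma F1_imp_ne:
  assumes "F1 n0 G lam x y r k" "k > 1"
  shows "x \<noteq> y"
proof
  assume "x = y"
  then obtain Z where x: "x \<in> G" and Z: "Z \<subseteq> geod n0 G x x" "k \<le> real (card Z)"
    using assms(1) by (auto simp: F1_def)
  interpret pointed_subgraph n0 G x by unfold_locales (rule x)
  have "card Z \<le> 1" using card_geod_subset_le[OF x Z(1)] gd_self[OF x] by simp
  then show False using Z(2) assms(2) by linarith
qed

lemma heat_kernel_le_of_F1:
  assumes x: "x \<in> G" and y: "y \<in> G" and z0: "z0 \<in> geod n0 G x y" and t: "t > 0"
    and F1: "F1 n0 G lam x z0 (2 * r) k" "F1 n0 G lam z0 y (2 * r) k" and k: "k \<ge> 3" and r: "r > 0"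
    and \<sigma>: "0 < \<sigma>" "\<sigma> \<le> 1" "2 * lam ^ 4 * \<sigma>\<^sup>2 \<le> 3 / 32" and lam: "lam > 0"
    and K: "\<And>w s. w \<in> {x, y, z0} \<Longrightarrow> t / 2 \<le> s \<Longrightarrow> s \<le> t \<Longrightarrow> heat_kernel s w w \<le> K"
  shows "heat_kernel t x y
    \<le> K * exp (2 * lam ^ 4 * \<sigma>\<^sup>2 / r ^ 3 * t) * (2 * exp 2 / \<sigma> * exp (- (\<sigma> / 2 * k)))"
proof -
  define \<theta> where "\<theta> = 2 * lam ^ 4 * \<sigma>\<^sup>2 / r ^ 3"
  have \<theta>: "\<theta> > 0" "\<theta> * r ^ 3 = 2 * lam ^ 4 * \<sigma>\<^sup>2" using lam \<sigma> r by (auto simp: \<theta>_def)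
  interpret killed_subgraph n0 G z0 \<theta>
    by unfold_locales (use geodD(1)[OF x y z0] \<theta> in auto)
  have ne: "x \<noteq> z0" "y \<noteq> z0"
    using F1_imp_ne[OF F1(1)] F1_imp_ne[OF F1(2)] k by auto
  obtain c where c: "c \<in> children z0" "x \<in> desc c"
    using desc_child_cases[OF desc_rt[OF x] ne(1)] by blast
  have deg: "deg x > 0" "deg y > 0" "deg z0 > 0"
    using parent_nbr[OF x ne(1)] parent_nbr[OF y ne(2)] children_nbr[OF c(1)] deg_pos_iff by blast+
  have K_nonneg: "K \<ge> 0" using K[of x t] heat_kernel_nonneg[of t x x] t by simp
  have u_le: "u v \<le> exp 2 / \<sigma> * exp (- (\<sigma> / 2 * k))" if "v \<in> {x, y}" for v
  proof (rule u_le_of_F1[OF _ k r \<sigma>(1,2) \<theta>(2)[symmetric]])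
    show "F1 n0 G lam v z0 (2 * r) k" using that F1(1) F1_commute[OF F1(2)] by auto
  qed (use \<theta>(2) \<sigma>(3) in simp)
  have "heat_kernel t x y \<le> K * exp (\<theta> * t) * (u x + u y)"
  proof (rule heat_kernel_le_hitting_laplace[OF theta_pos _ c(2)])
    show "separates z0 (desc c)" using c(1) by (intro separates_desc) (auto simp: children_def)
    show "y \<notin> desc c" by (rule not_desc_across_root[OF z0 x c(2) y c(1)])
    show "heat_kernel s z0 v \<le> K" if s: "t / 2 \<le> s" "s \<le> t" and v: "v \<in> {x, y}" for s v
    proof -
      have "deg v > 0" "s \<ge> 0" using v deg s t by auto
      then have "2 * heat_kernel s z0 v \<le> heat_kernel s z0 z0 + heat_kernel s v v"
        using deg(3) by (intro two_heat_kernel_le_diagonal)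
      then show ?thesis using K[of z0 s] K[of v s] v s by auto
    qed
  qed (use ne deg t in auto)
  also have "\<dots> \<le> K * exp (\<theta> * t) * (2 * exp 2 / \<sigma> * exp (- (\<sigma> / 2 * k)))"
    using u_le[of x] u_le[of y] K_nonneg by (intro mult_left_mono) auto
  finally show ?thesis by (simp add: \<theta>_def)
qed

end

section \<open>The heat kernel bound\<close>

lemma nat_floor_sqrt_bounds:
  assumes "N = nat \<lfloor>sqrt q\<rfloor>" "N \<ge> 1"
  shows "(real N)\<^sup>2 \<le> q" "q \<le> 4 * (real N)\<^sup>2"
proof -
  have N: "real N \<le> sqrt q" "sqrt q \<le> 2 * real N" using assms by linarith+
  then have q: "0 \<le> q" using assms(2) by (metis of_nat_0_le_iff order_trans real_sqrt_ge_0_iff)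
  show "(real N)\<^sup>2 \<le> q" using power_mono[OF N(1), of 2] q by simp
  show "q \<le> 4 * (real N)\<^sup>2" using power_mono[OF N(2), of 2] q by (simp add: power_mult_distrib)
qed

lemma cube_root_powr:
  fixes t :: real
  assumes "t > 0"
  shows "(t powr (1/3)) ^ 3 = t" "t powr (-2/3) = 1 / (t powr (1/3))\<^sup>2"
    "t * t powr (-2/3) = t powr (1/3)"
proof -
  show "(t powr (1/3)) ^ 3 = t" using assms by (simp add: powr_power)
  have "t powr (-2/3) = inverse (t powr (2/3))" by (simp flip: powr_minus)
  also have "t powr (2/3) = (t powr (1/3))\<^sup>2" using assms by (simp add: powr_power)
  finally show "t powr (-2/3) = 1 / (t powr (1/3))\<^sup>2" by (simp only: inverse_eq_divide)
  show "t * t powr (-2/3) = t powr (1/3)" using powr_add[of t 1 "-2/3"] assms by simp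
qed

lemma square_mult_exp_le:
  fixes a x :: real
  assumes "a > 0" "x \<ge> 0"
  shows "x\<^sup>2 * exp (- (2 * a * x)) \<le> 2 / a\<^sup>2 * exp (- (a * x))"
proof -
  have "(a * x)\<^sup>2 / 2 \<le> exp (a * x)"
    using exp_lower_Taylor_quadratic[of "a * x"] assms mult_nonneg_nonneg[of a x] by linarith
  then have "(a * x)\<^sup>2 * exp (- (2 * a * x)) \<le> 2 * exp (a * x) * exp (- (2 * a * x))"
    by (intro mult_right_mono) auto
  also have "\<dots> = 2 * exp (- (a * x))" by (simp add: mult_exp_exp)
  finally show ?thesis using assms(1) by (simp add: field_simps)
qed

lemma time_scale_le:
  fixes d t N :: real
  assumes "N\<^sup>2 \<le> d ^ 3 / t" "d > 0" "t > 0" "N > 0"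
  shows "t / (d / (2 * N)) ^ 3 \<le> 8 * N"
proof -
  have "t / (d / (2 * N)) ^ 3 = 8 * N ^ 3 / (d ^ 3 / t)"
    by (simp add: power_divide power_mult_distrib)
  also have "\<dots> \<le> 8 * N ^ 3 / N\<^sup>2" using assms by (intro divide_left_mono) auto
  also have "\<dots> = 8 * N" using assms by (simp add: power2_eq_square power3_eq_cube)
  finally show ?thesis .
qed

context tree_subgraph
begin

lemma good_heat_kernel_diagonal_le_scaled:
  assumes good: "good n0 G lam w R" and t: "t > 0" and s: "t / 2 \<le> s"
    and R: "lam\<^sup>2 * t powr (1/3) \<le> R" "R \<le> 4 * lam\<^sup>2 * t powr (1/3)"
  shows "heat_kernel s w w \<le> 2 * lam\<^sup>2 * t powr (-2/3)"
proof -
  define \<tau> where "\<tau> = t powr (1/3)"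
  have \<tau>: "\<tau> > 0" "\<tau> ^ 3 = t" using t by (auto simp: \<tau>_def cube_root_powr)
  have lam: "lam \<ge> 64" using good by (simp add: good_def)
  then have "0 < lam\<^sup>2 * \<tau>" using \<tau> by simp
  then have R_pos: "R > 0" using R(1) by (simp add: \<tau>_def)
  have "2 * lam ^ 6 / R\<^sup>2 \<le> 2 * lam ^ 6 / (lam\<^sup>2 * \<tau>)\<^sup>2"
    using R(1) \<open>0 < lam\<^sup>2 * \<tau>\<close> lam R_pos
    by (intro divide_left_mono power_mono mult_pos_pos zero_less_power) (auto simp: \<tau>_def)
  also have "\<dots> = 2 * lam\<^sup>2 / \<tau>\<^sup>2"
    using lam \<tau> by (simp add: field_simps flip: power_mult power_add)
  finally have volume_term: "2 * lam ^ 6 / R\<^sup>2 \<le> 2 * lam\<^sup>2 / \<tau>\<^sup>2" .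
  have "4 * R / (lam\<^sup>2 * s) \<le> 4 * (4 * lam\<^sup>2 * \<tau>) / (lam\<^sup>2 * (t / 2))"
    using R(2) R_pos s t lam by (intro frac_le mult_left_mono) (auto simp: \<tau>_def)
  also have "\<dots> = 32 / \<tau>\<^sup>2"
    using lam \<tau>(1) by (simp add: \<tau>(2)[symmetric] power2_eq_square power3_eq_cube)
  also have "\<dots> \<le> 2 * lam\<^sup>2 / \<tau>\<^sup>2"
    using power_mono[OF lam, of 2] by (intro divide_right_mono) auto
  finally have "4 * R / (lam\<^sup>2 * s) \<le> 2 * lam\<^sup>2 / \<tau>\<^sup>2" .
  moreover have "heat_kernel s w w \<le> max (2 * lam ^ 6 / R\<^sup>2) (4 * R / (lam\<^sup>2 * s))"
    using s t by (intro good_heat_kernel_diagonal_le[OF good R_pos]) simp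
  ultimately show ?thesis
    using volume_term unfolding cube_root_powr(2)[OF t] by (simp add: \<tau>_def)
qed

text \<open>The choice of \<open>\<sigma>\<close> makes \<open>\<theta> t\<close> at most \<open>\<sigma> N / 64\<close>, half of the gain \<open>\<sigma> N / 32\<close>.\<close>
lemma heat_kernel_le_of_Fstar:
  fixes x y z0 :: "nat list" and t lam :: real and N :: nat
  defines "\<sigma> \<equiv> 1 / (1024 * lam ^ 4)"
  assumes lam: "lam \<ge> 64" and x: "x \<in> G" and y: "y \<in> G" and t: "t > 0"
    and N: "N = nat \<lfloor>sqrt (real (gd x y) ^ 3 / t)\<rfloor>" and mid: "middle_point n0 G x y z0"
    and F: "Fstar n0 G lam z0 x y (real (gd x y) / real N) (real N / 8)
      (real (gd x y) ^ 3 * t powr (-2/3)) (real N)"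
  shows "heat_kernel t x y
    \<le> 4 * exp 2 / \<sigma> * t powr (-2/3) * ((real N)\<^sup>2 * exp (- (\<sigma> * real N / 64)))"
proof -
  define d where "d = real (gd x y)"
  define r where "r = d / (2 * real N)"
  have N_ge: "real N \<ge> 64" using F by (auto simp: Fstar_def Astar_def good_def)
  have q: "(real N)\<^sup>2 \<le> d ^ 3 / t" "d ^ 3 / t \<le> 4 * (real N)\<^sup>2"
    unfolding d_def using N N_ge by (auto intro: nat_floor_sqrt_bounds)
  have d: "d > 0" using q(1) N_ge by (cases "gd x y = 0") (auto simp: d_def)
  have r: "r > 0" "d / real N = 2 * r" using d N_ge by (auto simp: r_def)
  have lam_pow_ge: "lam ^ 4 \<ge> 1" using lam by (intro one_le_power) simp
  then have "lam ^ 4 * \<sigma> = 1 / 1024" by (auto simp: \<sigma>_def)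
  then have \<sigma>: "0 < \<sigma>" "\<sigma> \<le> 1" "2 * lam ^ 4 * \<sigma>\<^sup>2 = \<sigma> / 512"
    using lam_pow_ge by (auto simp: \<sigma>_def power2_eq_square divide_le_eq_1 simp flip: mult.assoc)
  have exponent: "2 * lam ^ 4 * \<sigma>\<^sup>2 / r ^ 3 * t \<le> \<sigma> * real N / 64"
    unfolding \<sigma>(3) using mult_left_mono[OF time_scale_le[OF q(1) d t], of "\<sigma> / 512"] N_ge \<sigma>(1)
    by (simp add: r_def)
  have "heat_kernel t x y \<le> 2 * (real N)\<^sup>2 * t powr (-2/3) * exp (2 * lam ^ 4 * \<sigma>\<^sup>2 / r ^ 3 * t)
      * (2 * exp 2 / \<sigma> * exp (- (\<sigma> / 2 * (real N / 8 / 2))))"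
  proof (rule heat_kernel_le_of_F1[OF x y _ t])
    show "z0 \<in> geod n0 G x y" using mid by (simp add: middle_point_def)
    show "F1 n0 G lam x z0 (2 * r) (real N / 8 / 2)" "F1 n0 G lam z0 y (2 * r) (real N / 8 / 2)"
      using F r(2) by (auto simp: Fstar_def d_def)
    fix w s assume w: "w \<in> {x, y, z0}" and s: "t / 2 \<le> s"
    have R: "d ^ 3 * t powr (-2/3) = d ^ 3 / t * t powr (1/3)"
      using t by (simp flip: cube_root_powr(3))
    show "heat_kernel s w w \<le> 2 * (real N)\<^sup>2 * t powr (-2/3)"
    proof (rule good_heat_kernel_diagonal_le_scaled[OF _ t s])
      show "good n0 G (real N) w (d ^ 3 * t powr (-2/3))"
        using F w by (auto simp: Fstar_def Astar_def d_def)
    qed (use q in \<open>auto simp only: R intro!: mult_right_mono powr_ge_zero\<close>)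
  qed (use N_ge r \<sigma> lam in auto)
  also have "\<dots> \<le> 2 * (real N)\<^sup>2 * t powr (-2/3) * exp (\<sigma> * real N / 64)
      * (2 * exp 2 / \<sigma> * exp (- (\<sigma> / 2 * (real N / 8 / 2))))"
    using exponent \<sigma>(1) by (intro mult_right_mono mult_left_mono) auto
  also have "\<dots> = 4 * exp 2 / \<sigma> * t powr (-2/3)
      * ((real N)\<^sup>2 * (exp (\<sigma> * real N / 64) * exp (- (\<sigma> * real N / 32))))" by simp
  also have "exp (\<sigma> * real N / 64) * exp (- (\<sigma> * real N / 32)) = exp (- (\<sigma> * real N / 64))"
    by (simp add: mult_exp_exp)
  finally show ?thesis .
qed

end

theorem theorem4p10:
  fixes n0 :: nat and G :: "nat list set" and lam1 :: real
  assumes "n0 \<ge> 2" and "lam1 \<ge> 64"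
    and "G \<subseteq> Bverts n0" and "infinite G" and "connectedG n0 G"
  shows "\<exists>c1 c2 :: real. c1 > 0 \<and> c2 > 0 \<and>
    (\<forall>x y z0 (t::real) (N::nat). x \<in> G \<longrightarrow> y \<in> G \<longrightarrow> t > 0 \<longrightarrow>
       N = nat \<lfloor>sqrt (real (gdist n0 G x y) ^ 3 / t)\<rfloor> \<longrightarrow> N \<ge> 8 \<longrightarrow>
       middle_point n0 G x y z0 \<longrightarrow>
       Fstar n0 G lam1 z0 x y (real (gdist n0 G x y) / real N) (real N / 8)
             (real (gdist n0 G x y) ^ 3 * t powr (-2/3)) (real N) \<longrightarrow>
       qt n0 G t x y \<le> c1 * t powr (-2/3) * exp (- c2 * real N))"
proof -
  interpret tree_subgraph n0 G by unfold_locales (rule assms(5))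
  define \<sigma> where "\<sigma> = 1 / (1024 * lam1 ^ 4)"
  define a where "a = \<sigma> / 128"
  define c1 where "c1 = 4 * exp 2 / \<sigma> * (2 / a\<^sup>2)"
  have \<sigma>: "\<sigma> > 0" using assms(2) by (simp add: \<sigma>_def)
  have polynomial_factor: "4 * exp 2 / \<sigma> * t powr (-2/3) * ((real N)\<^sup>2 * exp (- (\<sigma> * real N / 64)))
      \<le> c1 * t powr (-2/3) * exp (- a * real N)" for t N
    using mult_left_mono[OF square_mult_exp_le[of a "real N"], of "4 * exp 2 / \<sigma> * t powr (-2/3)"] \<sigma>
    by (simp add: a_def c1_def mult_ac)
  have "c1 > 0" "a > 0" using \<sigma> by (auto simp: c1_def a_def)
  moreover note order_trans[OF heat_kernel_le_of_Fstar[OF assms(2), folded \<sigma>_def] polynomial_factor]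
  ultimately show ?thesis unfolding qt_eq_heat_kernel by (intro exI[of _ c1] exI[of _ a]) auto
qed

end
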